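(* For every $\varepsilon>0$ there are $\delta>0$ and $n_0$ such that every graph $G$ with $n\ge n_0$ vertices and $\lambda_{4,3}(G)\ge\frac12-\delta$ is within edit distance at most $\varepsilon\binom n2$ from $T_{n/2,\,n/2}$ or $2K_{n/2}$.
   Context: Graphs are finite and simple. For a graph $G$ with $n\ge4$ vertices, $\lambda_{4,3}(G)$ is the number of $4$-subsets of $V(G)$ that span exactly $3$ edges of $G$, divided by $\binom n4$. $T_{a,b}$ is the complete bipartite graph with parts of sizes $a$ and $b$, and $2K_{a}$ is the vertex-disjoint union of two cliques with $a$ vertices each; floor/ceiling signs are omitted, so for odd $n$ the two parts (respectively cliques) have sizes $\lfloor n/2\rfloor$ and $\lceil n/2\rceil$. The edit distance between two graphs $G,H$ of the same order is the minimum of $|E(G)\bigtriangleup f(E(H))|$ over bijections $f:V(H)\to V(G)$. *)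

theory Defs
  imports Complex_Main
begin

type_synonym 'a graph = "'a set \<times> 'a set set"

abbreviation verts :: "'a graph \<Rightarrow> 'a set" where
  "verts \<equiv> fst"

abbreviation edges :: "'a graph \<Rightarrow> 'a set set" where
  "edges \<equiv> snd"

definition simple_graph :: "'a graph \<Rightarrow> bool" where
  "simple_graph G \<longleftrightarrow> finite (verts G) \<and> (\<forall>e\<in>edges G. e \<subseteq> verts G \<and> card e = 2)"

definition edge_inducibility_density :: "nat \<Rightarrow> nat \<Rightarrow> 'a graph \<Rightarrow> real" where
  "edge_inducibility_density k l G =
     real (card {X. X \<subseteq> verts G \<and> card X = k \<and> card {e \<in> edges G. e \<subseteq> X} = l})
       / real (card (verts G) choose k)"

definition complete_bipartite :: "nat \<Rightarrow> nat \<Rightarrow> (nat + nat) graph" where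
  "complete_bipartite a b =
     ({..<a} <+> {..<b}, {{Inl i, Inr j} | i j. i < a \<and> j < b})"

definition two_cliques :: "nat \<Rightarrow> nat \<Rightarrow> (nat + nat) graph" where
  "two_cliques a b =
     ({..<a} <+> {..<b},
      {{Inl i, Inl j} | i j. i < a \<and> j < a \<and> i \<noteq> j} \<union>
      {{Inr i, Inr j} | i j. i < b \<and> j < b \<and> i \<noteq> j})"

text \<open>Meaningful for finite graphs with equally many vertices, when there is a bijection and
  the least value is the minimum over all of them.\<close>

definition edit_distance :: "'a graph \<Rightarrow> 'b graph \<Rightarrow> nat" where
  "edit_distance G H =
     (LEAST d. \<exists>f. bij_betw f (verts H) (verts G) \<and>
        d = card (sym_diff (edges G) ((`) f ` edges H)))"

lemma simple_graph_complete_bipartite: "simple_graph (complete_bipartite a b)"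
  by (auto simp: simple_graph_def complete_bipartite_def)

lemma simple_graph_two_cliques: "simple_graph (two_cliques a b)"
  by (auto simp: simple_graph_def two_cliques_def)

lemma card_verts_complete_bipartite: "card (verts (complete_bipartite a b)) = a + b"
  by (simp add: complete_bipartite_def card_Plus)

lemma card_verts_two_cliques: "card (verts (two_cliques a b)) = a + b"
  by (simp add: two_cliques_def card_Plus)

end

theory Submission
  imports Defs "HOL-Analysis.Convex"
begin

text \<open>
  Write the graph as a symmetric sign matrix \<open>w\<close> (edge \<open>= 1\<close>, non-edge \<open>= -1\<close>) and fix an ordered
  pair \<open>x, y\<close> of vertices. A flag on \<open>x, y\<close> is a choice of two further vertices \<open>z, u\<close>. Some
  explicit functionals of flags, found by semidefinite programming, have the property that a
  constant minus a weighted sum of their squares, averaged over \<open>x, y\<close>, dominates the 3-edge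
  density; this is a finite inequality about graphs on 6 vertices. Two of the squares are kept:
  they show that near-extremality forces the entries of \<open>w\<close> to sum to almost 0, and almost every
  4-cycle to have sign product 1. Fixing one edge of the cycle, the latter says that \<open>w x z\<close> is
  almost \<open>\<plusminus> a x * a z\<close> for some sign vector \<open>a\<close>, so the graph is close to a complete bipartite
  graph or to two cliques, and the former says that the two sides are almost equal.
\<close>

section \<open>Flags and the coefficients of the certificate\<close>

text \<open>
  The classes of sign patterns on \<open>x, y, z, u\<close> on which all the functionals used below agree. Both
  swapping \<open>z, u\<close> and complementing the graph preserve the class.
\<close>

datatype flag = C0 | C1 | C2 | C3 | C4 | C5 | C6 | C7 | C8 | C9 | C10 | C11 | C12 | C13

fun flag_rel :: "bool \<Rightarrow> bool \<Rightarrow> bool \<Rightarrow> bool \<Rightarrow> bool \<Rightarrow> flag" where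
  "flag_rel True True True True True = C0" | "flag_rel True True True True False = C1" |
  "flag_rel True True True False True = C2" | "flag_rel True True True False False = C3" |
  "flag_rel True True False True True = C2" | "flag_rel True True False True False = C3" |
  "flag_rel True True False False True = C4" | "flag_rel True True False False False = C5" |
  "flag_rel True False True True True = C6" | "flag_rel True False True True False = C7" |
  "flag_rel True False True False True = C0" | "flag_rel True False True False False = C5" |
  "flag_rel True False False True True = C0" | "flag_rel True False False True False = C5" |
  "flag_rel True False False False True = C8" | "flag_rel True False False False False = C9" |
  "flag_rel False True True True True = C6" | "flag_rel False True True True False = C7" |
  "flag_rel False True True False True = C0" | "flag_rel False True True False False = C5" |
  "flag_rel False True False True True = C0" | "flag_rel False True False True False = C5" |
  "flag_rel False True False False True = C8" | "flag_rel False True False False False = C9" |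
  "flag_rel False False True True True = C10" | "flag_rel False False True True False = C5" |
  "flag_rel False False True False True = C11" | "flag_rel False False True False False = C12" |
  "flag_rel False False False True True = C11" | "flag_rel False False False True False = C12" |
  "flag_rel False False False False True = C0" | "flag_rel False False False False False = C13"

definition flag_of :: "bool \<Rightarrow> bool \<Rightarrow> bool \<Rightarrow> bool \<Rightarrow> bool \<Rightarrow> bool \<Rightarrow> flag" where
  "flag_of xy xz xu yz yu zu = flag_rel (xz = xy) (xu = xy) (yz = xy) (yu = xy) (zu = xy)"

text \<open>
  With \<open>d\<^sub>x\<close> and \<open>e\<^sub>x\<close> the contributions of \<open>z, u\<close> to the averages of \<open>w x z\<close> and \<open>w x z * w z u\<close>, etc.,
  \<open>lin0\<close> is half of the symmetric combination
  \<open>7 (e\<^sub>x + e\<^sub>y) - 8 w x y (d\<^sub>x + d\<^sub>y) + w x y (d\<^sub>x + d\<^sub>y) c\<close> where \<open>c\<close> is the contribution to the average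
  of \<open>w x z * w y z\<close>; the functionals \<open>lin1\<close>, \<open>lin2\<close>, \<open>lin3\<close> are similar antisymmetric combinations.
  All of them vanish on average in the balanced extremal graphs.
\<close>

primrec three_sign :: "flag \<Rightarrow> int" where
  "three_sign C0 = 1" | "three_sign C1 = 1" | "three_sign C2 = 1" | "three_sign C3 = 1" |
  "three_sign C4 = 1" | "three_sign C5 = -1" | "three_sign C6 = 1" | "three_sign C7 = 1" |
  "three_sign C8 = -1" | "three_sign C9 = 1" | "three_sign C10 = 1" | "three_sign C11 = -1" |
  "three_sign C12 = 1" | "three_sign C13 = 1"

primrec opp_sign :: "flag \<Rightarrow> int" where
  "opp_sign C0 = 1" | "opp_sign C1 = -1" | "opp_sign C2 = 1" | "opp_sign C3 = -1" |
  "opp_sign C4 = 1" | "opp_sign C5 = -1" | "opp_sign C6 = 1" | "opp_sign C7 = -1" |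
  "opp_sign C8 = 1" | "opp_sign C9 = -1" | "opp_sign C10 = 1" | "opp_sign C11 = 1" |
  "opp_sign C12 = -1" | "opp_sign C13 = -1"

primrec lin0 :: "flag \<Rightarrow> int" where
  "lin0 C0 = 0" | "lin0 C1 = -14" | "lin0 C2 = -1" | "lin0 C3 = -8" |
  "lin0 C4 = 0" | "lin0 C5 = 0" | "lin0 C6 = -1" | "lin0 C7 = -8" |
  "lin0 C8 = 1" | "lin0 C9 = 8" | "lin0 C10 = 0" | "lin0 C11 = 1" |
  "lin0 C12 = 8" | "lin0 C13 = 14"

primrec lin1 :: "flag \<Rightarrow> int" where
  "lin1 C0 = 0" | "lin1 C1 = 0" | "lin1 C2 = -1" | "lin1 C3 = 3" |
  "lin1 C4 = -16" | "lin1 C5 = 0" | "lin1 C6 = 1" | "lin1 C7 = -3" |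
  "lin1 C8 = -17" | "lin1 C9 = -9" | "lin1 C10 = 16" | "lin1 C11 = 17" |
  "lin1 C12 = 9" | "lin1 C13 = 0"

primrec lin2 :: "flag \<Rightarrow> int" where
  "lin2 C0 = 0" | "lin2 C1 = 0" | "lin2 C2 = -8" | "lin2 C3 = -13" |
  "lin2 C4 = -18" | "lin2 C5 = 0" | "lin2 C6 = 8" | "lin2 C7 = 13" |
  "lin2 C8 = 2" | "lin2 C9 = 1" | "lin2 C10 = 18" | "lin2 C11 = -2" |
  "lin2 C12 = -1" | "lin2 C13 = 0"

primrec lin3 :: "flag \<Rightarrow> int" where
  "lin3 C0 = 0" | "lin3 C1 = 0" | "lin3 C2 = 3" | "lin3 C3 = 3" |
  "lin3 C4 = 8" | "lin3 C5 = 0" | "lin3 C6 = -3" | "lin3 C7 = -3" |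
  "lin3 C8 = 5" | "lin3 C9 = -3" | "lin3 C10 = -8" | "lin3 C11 = -5" |
  "lin3 C12 = 3" | "lin3 C13 = 0"

primrec odd_cycle :: "flag \<Rightarrow> int" where
  "odd_cycle C0 = 0" | "odd_cycle C1 = 0" | "odd_cycle C2 = 1" | "odd_cycle C3 = 1" |
  "odd_cycle C4 = 0" | "odd_cycle C5 = 0" | "odd_cycle C6 = 1" | "odd_cycle C7 = 1" |
  "odd_cycle C8 = 1" | "odd_cycle C9 = 1" | "odd_cycle C10 = 0" | "odd_cycle C11 = 1" |
  "odd_cycle C12 = 1" | "odd_cycle C13 = 0"

text \<open>\<open>three_sign\<close> averages to 1 minus twice the proportion of quadruples with
  three edges, so a nonnegative average means a proportion of at most 1/2. The form takes 916 times
  it, split evenly between \<open>c\<close> and \<open>d\<close> (hence 458), and subtracts a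
  diagonal positive semidefinite form whose weights 916, 17, 8, 8, 42, 1 belong to the
  certificate.\<close>

definition flag_form :: "flag \<Rightarrow> flag \<Rightarrow> int" where
  "flag_form c d = 458 * (three_sign c + three_sign d) - 916 * (opp_sign c * opp_sign d)
     - 17 * (lin0 c * lin0 d) - 8 * (lin1 c * lin1 d) - 8 * (lin2 c * lin2 d)
     - 42 * (lin3 c * lin3 d) - odd_cycle c * odd_cycle d"

text \<open>Together with \<open>flag_of_table\<close>, this reduces the six-vertex check to lookups
  and integer additions.\<close>

lemma flag_form_table:
  "flag_form C0 C0 = 0" "flag_form C0 C1 = 1832" "flag_form C0 C2 = 0" "flag_form C0 C3 = 1832" "flag_form C0 C4 = 0" "flag_form C0 C5 = 916" "flag_form C0 C6 = 0"
  "flag_form C0 C7 = 1832" "flag_form C0 C8 = -916" "flag_form C0 C9 = 1832" "flag_form C0 C10 = 0" "flag_form C0 C11 = -916" "flag_form C0 C12 = 1832" "flag_form C0 C13 = 1832"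
  "flag_form C1 C0 = 1832" "flag_form C1 C1 = -3332" "flag_form C1 C2 = 1594" "flag_form C1 C3 = -1904" "flag_form C1 C4 = 1832" "flag_form C1 C5 = -916" "flag_form C1 C6 = 1594"
  "flag_form C1 C7 = -1904" "flag_form C1 C8 = 1154" "flag_form C1 C9 = 1904" "flag_form C1 C10 = 1832" "flag_form C1 C11 = 1154" "flag_form C1 C12 = 1904" "flag_form C1 C13 = 3332"
  "flag_form C2 C0 = 0" "flag_form C2 C1 = 1594" "flag_form C2 C2 = -916" "flag_form C2 C3 = 509" "flag_form C2 C4 = -2288" "flag_form C2 C5 = 916" "flag_form C2 C6 = 880"
  "flag_form C2 C7 = 2881" "flag_form C2 C8 = -1538" "flag_form C2 C9 = 2337" "flag_form C2 C10 = 2288" "flag_form C2 C11 = -262" "flag_form C2 C12 = 1597" "flag_form C2 C13 = 2070"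
  "flag_form C3 C0 = 1832" "flag_form C3 C1 = -1904" "flag_form C3 C2 = 509" "flag_form C3 C3 = -2891" "flag_form C3 C4 = -664" "flag_form C3 C5 = -916" "flag_form C3 C6 = 2881"
  "flag_form C3 C7 = 713" "flag_form C3 C8 = 1037" "flag_form C3 C9 = 1785" "flag_form C3 C10 = 4328" "flag_form C3 C11 = 1065" "flag_form C3 C12 = 389" "flag_form C3 C13 = 1904"
  "flag_form C4 C0 = 0" "flag_form C4 C1 = 1832" "flag_form C4 C2 = -2288" "flag_form C4 C3 = -664" "flag_form C4 C4 = -7328" "flag_form C4 C5 = 916" "flag_form C4 C6 = 2288"
  "flag_form C4 C7 = 4328" "flag_form C4 C8 = -4484" "flag_form C4 C9 = 1832" "flag_form C4 C10 = 7328" "flag_form C4 C11 = 2652" "flag_form C4 C12 = 1832" "flag_form C4 C13 = 1832"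
  "flag_form C5 C0 = 916" "flag_form C5 C1 = -916" "flag_form C5 C2 = 916" "flag_form C5 C3 = -916" "flag_form C5 C4 = 916" "flag_form C5 C5 = -1832" "flag_form C5 C6 = 916"
  "flag_form C5 C7 = -916" "flag_form C5 C8 = 0" "flag_form C5 C9 = -916" "flag_form C5 C10 = 916" "flag_form C5 C11 = 0" "flag_form C5 C12 = -916" "flag_form C5 C13 = -916"
  "flag_form C6 C0 = 0" "flag_form C6 C1 = 1594" "flag_form C6 C2 = 880" "flag_form C6 C3 = 2881" "flag_form C6 C4 = 2288" "flag_form C6 C5 = 916" "flag_form C6 C6 = -916"
  "flag_form C6 C7 = 509" "flag_form C6 C8 = -262" "flag_form C6 C9 = 1597" "flag_form C6 C10 = -2288" "flag_form C6 C11 = -1538" "flag_form C6 C12 = 2337" "flag_form C6 C13 = 2070"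
  "flag_form C7 C0 = 1832" "flag_form C7 C1 = -1904" "flag_form C7 C2 = 2881" "flag_form C7 C3 = 713" "flag_form C7 C4 = 4328" "flag_form C7 C5 = -916" "flag_form C7 C6 = 509"
  "flag_form C7 C7 = -2891" "flag_form C7 C8 = 1065" "flag_form C7 C9 = 389" "flag_form C7 C10 = -664" "flag_form C7 C11 = 1037" "flag_form C7 C12 = 1785" "flag_form C7 C13 = 1904"
  "flag_form C8 C0 = -916" "flag_form C8 C1 = 1154" "flag_form C8 C2 = -1538" "flag_form C8 C3 = 1037" "flag_form C8 C4 = -4484" "flag_form C8 C5 = 0" "flag_form C8 C6 = -262"
  "flag_form C8 C7 = 1065" "flag_form C8 C8 = -5244" "flag_form C8 C9 = 169" "flag_form C8 C10 = 2652" "flag_form C8 C11 = 1544" "flag_form C8 C12 = 1389" "flag_form C8 C13 = 678"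
  "flag_form C9 C0 = 1832" "flag_form C9 C1 = 1904" "flag_form C9 C2 = 2337" "flag_form C9 C3 = 1785" "flag_form C9 C4 = 1832" "flag_form C9 C5 = -916" "flag_form C9 C6 = 1597"
  "flag_form C9 C7 = 389" "flag_form C9 C8 = 169" "flag_form C9 C9 = -2123" "flag_form C9 C10 = 1832" "flag_form C9 C11 = 1389" "flag_form C9 C12 = -55" "flag_form C9 C13 = -1904"
  "flag_form C10 C0 = 0" "flag_form C10 C1 = 1832" "flag_form C10 C2 = 2288" "flag_form C10 C3 = 4328" "flag_form C10 C4 = 7328" "flag_form C10 C5 = 916" "flag_form C10 C6 = -2288"
  "flag_form C10 C7 = -664" "flag_form C10 C8 = 2652" "flag_form C10 C9 = 1832" "flag_form C10 C10 = -7328" "flag_form C10 C11 = -4484" "flag_form C10 C12 = 1832" "flag_form C10 C13 = 1832"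
  "flag_form C11 C0 = -916" "flag_form C11 C1 = 1154" "flag_form C11 C2 = -262" "flag_form C11 C3 = 1065" "flag_form C11 C4 = 2652" "flag_form C11 C5 = 0" "flag_form C11 C6 = -1538"
  "flag_form C11 C7 = 1037" "flag_form C11 C8 = 1544" "flag_form C11 C9 = 1389" "flag_form C11 C10 = -4484" "flag_form C11 C11 = -5244" "flag_form C11 C12 = 169" "flag_form C11 C13 = 678"
  "flag_form C12 C0 = 1832" "flag_form C12 C1 = 1904" "flag_form C12 C2 = 1597" "flag_form C12 C3 = 389" "flag_form C12 C4 = 1832" "flag_form C12 C5 = -916" "flag_form C12 C6 = 2337"
  "flag_form C12 C7 = 1785" "flag_form C12 C8 = 1389" "flag_form C12 C9 = -55" "flag_form C12 C10 = 1832" "flag_form C12 C11 = 169" "flag_form C12 C12 = -2123" "flag_form C12 C13 = -1904"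
  "flag_form C13 C0 = 1832" "flag_form C13 C1 = 3332" "flag_form C13 C2 = 2070" "flag_form C13 C3 = 1904" "flag_form C13 C4 = 1832" "flag_form C13 C5 = -916" "flag_form C13 C6 = 2070"
  "flag_form C13 C7 = 1904" "flag_form C13 C8 = 678" "flag_form C13 C9 = -1904" "flag_form C13 C10 = 1832" "flag_form C13 C11 = 678" "flag_form C13 C12 = -1904" "flag_form C13 C13 = -3332"
  by (simp_all add: flag_form_def)

lemma flag_of_table:
  "flag_of True True True True True True = C0"
  "flag_of True True True True True False = C1"
  "flag_of True True True True False True = C2"
  "flag_of True True True True False False = C3"
  "flag_of True True True False True True = C2"
  "flag_of True True True False True False = C3"
  "flag_of True True True False False True = C4"
  "flag_of True True True False False False = C5"
  "flag_of True True False True True True = C6"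
  "flag_of True True False True True False = C7"
  "flag_of True True False True False True = C0"
  "flag_of True True False True False False = C5"
  "flag_of True True False False True True = C0"
  "flag_of True True False False True False = C5"
  "flag_of True True False False False True = C8"
  "flag_of True True False False False False = C9"
  "flag_of True False True True True True = C6"
  "flag_of True False True True True False = C7"
  "flag_of True False True True False True = C0"
  "flag_of True False True True False False = C5"
  "flag_of True False True False True True = C0"
  "flag_of True False True False True False = C5"
  "flag_of True False True False False True = C8"
  "flag_of True False True False False False = C9"
  "flag_of True False False True True True = C10"
  "flag_of True False False True True False = C5"
  "flag_of True False False True False True = C11"
  "flag_of True False False True False False = C12"
  "flag_of True False False False True True = C11"
  "flag_of True False False False True False = C12"
  "flag_of True False False False False True = C0"
  "flag_of True False False False False False = C13"
  "flag_of False True True True True True = C13"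
  "flag_of False True True True True False = C0"
  "flag_of False True True True False True = C12"
  "flag_of False True True True False False = C11"
  "flag_of False True True False True True = C12"
  "flag_of False True True False True False = C11"
  "flag_of False True True False False True = C5"
  "flag_of False True True False False False = C10"
  "flag_of False True False True True True = C9"
  "flag_of False True False True True False = C8"
  "flag_of False True False True False True = C5"
  "flag_of False True False True False False = C0"
  "flag_of False True False False True True = C5"
  "flag_of False True False False True False = C0"
  "flag_of False True False False False True = C7"
  "flag_of False True False False False False = C6"
  "flag_of False False True True True True = C9"
  "flag_of False False True True True False = C8"
  "flag_of False False True True False True = C5"
  "flag_of False False True True False False = C0"
  "flag_of False False True False True True = C5"
  "flag_of False False True False True False = C0"
  "flag_of False False True False False True = C7"
  "flag_of False False True False False False = C6"
  "flag_of False False False True True True = C5"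
  "flag_of False False False True True False = C4"
  "flag_of False False False True False True = C3"
  "flag_of False False False True False False = C2"
  "flag_of False False False False True True = C3"
  "flag_of False False False False True False = C2"
  "flag_of False False False False False True = C1"
  "flag_of False False False False False False = C0"
  by (simp_all add: flag_of_def)

section \<open>The inequality on six vertices\<close>

definition six_form ::
  "bool \<Rightarrow> bool \<Rightarrow> bool \<Rightarrow> bool \<Rightarrow> bool \<Rightarrow> bool \<Rightarrow>
    bool \<Rightarrow> bool \<Rightarrow> bool \<Rightarrow> bool \<Rightarrow> bool \<Rightarrow> int" where
  "six_form xy xz xu yz yu zu xp xq yp yq pq =
     flag_form (flag_of xy xz xu yz yu zu) (flag_of xy xp xq yp yq pq)"

text \<open>The sum of \<open>six_form\<close> over the 45 ways to split six vertices \<open>xy | zu | pq\<close>, the first pair being marked.\<close>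

definition sym_form where
  "sym_form ab ac ad ae af bc bd be bf cd ce cf de df ef =
     six_form ab ac ad bc bd cd ae af be bf ef +
     six_form ab ac ae bc be ce ad af bd bf df +
     six_form ab ac af bc bf cf ad ae bd be de +
     six_form ac ab ad bc cd bd ae af ce cf ef +
     six_form ac ab ae bc ce be ad af cd cf df +
     six_form ac ab af bc cf bf ad ae cd ce de +
     six_form ad ab ac bd cd bc ae af de df ef +
     six_form ad ab ae bd de be ac af cd df cf +
     six_form ad ab af bd df bf ac ae cd de ce +
     six_form ae ab ac be ce bc ad af de ef df +
     six_form ae ab ad be de bd ac af ce ef cf +
     six_form ae ab af be ef bf ac ad ce de cd +
     six_form af ab ac bf cf bc ad ae df ef de +
     six_form af ab ad bf df bd ac ae cf ef ce +
     six_form af ab ae bf ef be ac ad cf df cd +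
     six_form bc ab bd ac cd ad be bf ce cf ef +
     six_form bc ab be ac ce ae bd bf cd cf df +
     six_form bc ab bf ac cf af bd be cd ce de +
     six_form bd ab bc ad cd ac be bf de df ef +
     six_form bd ab be ad de ae bc bf cd df cf +
     six_form bd ab bf ad df af bc be cd de ce +
     six_form be ab bc ae ce ac bd bf de ef df +
     six_form be ab bd ae de ad bc bf ce ef cf +
     six_form be ab bf ae ef af bc bd ce de cd +
     six_form bf ab bc af cf ac bd be df ef de +
     six_form bf ab bd af df ad bc be cf ef ce +
     six_form bf ab be af ef ae bc bd cf df cd +
     six_form cd ac bc ad bd ab ce cf de df ef +
     six_form cd ac ce ad de ae bc cf bd df bf +
     six_form cd ac cf ad df af bc ce bd de be +
     six_form ce ac bc ae be ab cd cf de ef df +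
     six_form ce ac cd ae de ad bc cf be ef bf +
     six_form ce ac cf ae ef af bc cd be de bd +
     six_form cf ac bc af bf ab cd ce df ef de +
     six_form cf ac cd af df ad bc ce bf ef be +
     six_form cf ac ce af ef ae bc cd bf df bd +
     six_form de ad bd ae be ab cd df ce ef cf +
     six_form de ad cd ae ce ac bd df be ef bf +
     six_form de ad df ae ef af bd cd be ce bc +
     six_form df ad bd af bf ab cd de cf ef ce +
     six_form df ad cd af cf ac bd de bf ef be +
     six_form df ad de af ef ae bd cd bf cf bc +
     six_form ef ae be af bf ab ce de cf df cd +
     six_form ef ae ce af cf ac be de bf df bd +
     six_form ef ae de af df ad be ce bf cf bc"

lemma all_bool: "(\<forall>x. P x) \<longleftrightarrow> P True \<and> P False"
  by (metis (full_types))

lemma flag_of_compl: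
  "flag_of (\<not> xy) (\<not> xz) (\<not> xu) (\<not> yz) (\<not> yu) (\<not> zu) = flag_of xy xz xu yz yu zu"
  by (simp add: flag_of_def)

text \<open>Flags record only agreement with the marked pair, so complementing changes nothing. This
  allows \<open>ab\<close> to be taken as an edge, which halves the case check.\<close>

lemma sym_form_compl:
  "sym_form (\<not> ab) (\<not> ac) (\<not> ad) (\<not> ae) (\<not> af) (\<not> bc) (\<not> bd) (\<not> be) (\<not> bf)
     (\<not> cd) (\<not> ce) (\<not> cf) (\<not> de) (\<not> df) (\<not> ef) =
   sym_form ab ac ad ae af bc bd be bf cd ce cf de df ef"
  unfolding sym_form_def six_form_def flag_of_compl ..

text \<open>The computational core: once \<open>ab\<close> is an edge, the other 14 pairs leave 2^14
  labelled graphs, each settled by evaluation. A single term can be negative, for instance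
  \<open>flag_form C4 C4\<close>; it is the sum over all splittings that has a sign.\<close>

lemma sym_form_nonneg_edge:
  "\<forall>ac ad ae af bc bd be bf cd ce cf de df ef.
     0 \<le> sym_form True ac ad ae af bc bd be bf cd ce cf de df ef"
  unfolding sym_form_def six_form_def
  by (simp only: all_bool flag_of_table flag_form_table arith_simps arith_special rel_simps
      simp_thms add_0_left add_0_right add_numeral_special diff_numeral_special le_numeral_extra)

lemma sym_form_nonneg: "0 \<le> sym_form ab ac ad ae af bc bd be bf cd ce cf de df ef"
proof (cases ab)
  case True
  then show ?thesis using sym_form_nonneg_edge by simp
next
  case False
  have "0 \<le> sym_form True (\<not> ac) (\<not> ad) (\<not> ae) (\<not> af) (\<not> bc) (\<not> bd) (\<not> be) (\<not> bf)
      (\<not> cd) (\<not> ce) (\<not> cf) (\<not> de) (\<not> df) (\<not> ef)"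
    using sym_form_nonneg_edge by blast
  then show ?thesis
    using sym_form_compl[of ab ac ad ae af bc bd be bf cd ce cf de df ef] False by simp
qed

section \<open>Averaging over tuples of six vertices\<close>

lemma sum_lists_length_Suc:
  fixes g :: "'a list \<Rightarrow> 'b :: comm_monoid_add"
  assumes "finite V"
  shows "(\<Sum>xs | set xs \<subseteq> V \<and> length xs = Suc k. g xs) =
    (\<Sum>x\<in>V. \<Sum>xs | set xs \<subseteq> V \<and> length xs = k. g (x # xs))"
proof -
  have "(\<Sum>xs | set xs \<subseteq> V \<and> length xs = Suc k. g xs) =
      (\<Sum>(x, xs)\<in>V \<times> {xs. set xs \<subseteq> V \<and> length xs = k}. g (x # xs))"
    by (rule sum.reindex_bij_witness[of _ "\<lambda>(x, xs). x # xs" "\<lambda>xs. (hd xs, tl xs)"])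
       (auto simp: length_Suc_conv)
  then show ?thesis
    using assms by (simp add: sum.cartesian_product finite_lists_length_eq)
qed

lemma sum_lists_length_0: "(\<Sum>xs | set xs \<subseteq> V \<and> length xs = 0. g xs) = g []"
proof -
  have "{xs. set xs \<subseteq> V \<and> length xs = 0} = {[]}" by auto
  then show ?thesis by simp
qed

text \<open>Since \<open>is\<close> reaches every position, rearranging by \<open>is\<close> is
  injective on lists of length \<open>k\<close>, and an injective self-map of a finite set is onto.
  Treating tuples as lists turns a permutation of the summation variables into one
  reindexing.\<close>

lemma sum_lists_permute:
  fixes g :: "'a list \<Rightarrow> 'b :: comm_monoid_add"
  assumes "finite V" and "length is = k" and "set is = {..<k}"
  shows "(\<Sum>xs | set xs \<subseteq> V \<and> length xs = k. g (map ((!) xs) is)) =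
    (\<Sum>xs | set xs \<subseteq> V \<and> length xs = k. g xs)"
proof -
  let ?L = "{xs. set xs \<subseteq> V \<and> length xs = k}"
  have inj: "inj_on (\<lambda>xs. map ((!) xs) is) ?L"
  proof (rule inj_onI)
    fix xs ys assume xs: "xs \<in> ?L" and ys: "ys \<in> ?L"
      and eq: "map ((!) xs) is = map ((!) ys) is"
    have "xs ! i = ys ! i" if "i < k" for i
      using eq that assms(3) by (auto simp: map_eq_conv)
    then show "xs = ys" using xs ys by (auto intro: nth_equalityI)
  qed
  have "(\<lambda>xs. map ((!) xs) is) ` ?L \<subseteq> ?L"
    using assms by (auto simp: subset_iff)
  then have "(\<lambda>xs. map ((!) xs) is) ` ?L = ?L"
    using inj finite_lists_length_eq[OF assms(1), of k] by (simp add: endo_inj_surj)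
  then show ?thesis
    using sum.reindex[OF inj, of g] by simp
qed

lemma sum_sum_list_swap:
  fixes f :: "'a \<Rightarrow> 'b \<Rightarrow> 'c :: comm_monoid_add"
  shows "(\<Sum>x\<in>A. \<Sum>y\<leftarrow>ys. f x y) = (\<Sum>y\<leftarrow>ys. \<Sum>x\<in>A. f x y)"
  by (induction ys) (simp_all add: sum.distrib)

text \<open>15 marked pairs times 3 ways to pair up the other four positions. Positions 0 and 1 of
  each list name the marked pair, the next two and the last two the free pairs, matching the terms
  of \<open>sym_form\<close>.\<close>

definition splittings :: "nat list list" where
  "splittings =
    [[0, 1, 2, 3, 4, 5], [0, 1, 2, 4, 3, 5], [0, 1, 2, 5, 3, 4], [0, 2, 1, 3, 4, 5], [0, 2,
     1, 4, 3, 5], [0, 2, 1, 5, 3, 4], [0, 3, 1, 2, 4, 5], [0, 3, 1, 4, 2, 5], [0, 3, 1, 5, 2,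
     4], [0, 4, 1, 2, 3, 5], [0, 4, 1, 3, 2, 5], [0, 4, 1, 5, 2, 3], [0, 5, 1, 2, 3, 4], [0,
     5, 1, 3, 2, 4], [0, 5, 1, 4, 2, 3], [1, 2, 0, 3, 4, 5], [1, 2, 0, 4, 3, 5], [1, 2, 0, 5,
     3, 4], [1, 3, 0, 2, 4, 5], [1, 3, 0, 4, 2, 5], [1, 3, 0, 5, 2, 4], [1, 4, 0, 2, 3, 5],
     [1, 4, 0, 3, 2, 5], [1, 4, 0, 5, 2, 3], [1, 5, 0, 2, 3, 4], [1, 5, 0, 3, 2, 4], [1, 5,
     0, 4, 2, 3], [2, 3, 0, 1, 4, 5], [2, 3, 0, 4, 1, 5], [2, 3, 0, 5, 1, 4], [2, 4, 0, 1, 3,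
     5], [2, 4, 0, 3, 1, 5], [2, 4, 0, 5, 1, 3], [2, 5, 0, 1, 3, 4], [2, 5, 0, 3, 1, 4], [2,
     5, 0, 4, 1, 3], [3, 4, 0, 1, 2, 5], [3, 4, 0, 2, 1, 5], [3, 4, 0, 5, 1, 2], [3, 5, 0, 1,
     2, 4], [3, 5, 0, 2, 1, 4], [3, 5, 0, 4, 1, 2], [4, 5, 0, 1, 2, 3], [4, 5, 0, 2, 1, 3],
     [4, 5, 0, 3, 1, 2]]"

lemma length_splittings: "length splittings = 45"
  by (simp add: splittings_def)

lemma splittings_permute:
  assumes "is \<in> set splittings"
  shows "length is = 6" "set is = {..<6}"
  using assms by (auto simp: splittings_def lessThan_nat_numeral lessThan_Suc)

definition tuple_form :: "('a \<Rightarrow> 'a \<Rightarrow> bool) \<Rightarrow> 'a list \<Rightarrow> int" where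
  "tuple_form E xs = six_form (E (xs!0) (xs!1)) (E (xs!0) (xs!2)) (E (xs!0) (xs!3)) (E (xs!1) (xs!2))
     (E (xs!1) (xs!3)) (E (xs!2) (xs!3)) (E (xs!0) (xs!4)) (E (xs!0) (xs!5)) (E (xs!1) (xs!4))
     (E (xs!1) (xs!5)) (E (xs!4) (xs!5))"

lemma sum_splittings_nonneg:
  assumes sym: "\<And>x y. E x y = E y x"
  shows "0 \<le> (\<Sum>is\<leftarrow>splittings. tuple_form E (map ((!) xs) is))"
proof -
  \<comment> \<open>Orienting every pair increasingly makes the terms literally those of
    \<open>sym_form\<close>.\<close>
  have swap: "E (xs!1) (xs!0) = E (xs!0) (xs!1)"
    "E (xs!2) (xs!0) = E (xs!0) (xs!2)" "E (xs!2) (xs!1) = E (xs!1) (xs!2)"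
    "E (xs!3) (xs!0) = E (xs!0) (xs!3)" "E (xs!3) (xs!1) = E (xs!1) (xs!3)"
    "E (xs!3) (xs!2) = E (xs!2) (xs!3)" "E (xs!4) (xs!0) = E (xs!0) (xs!4)"
    "E (xs!4) (xs!1) = E (xs!1) (xs!4)" "E (xs!4) (xs!2) = E (xs!2) (xs!4)"
    "E (xs!4) (xs!3) = E (xs!3) (xs!4)" "E (xs!5) (xs!0) = E (xs!0) (xs!5)"
    "E (xs!5) (xs!1) = E (xs!1) (xs!5)" "E (xs!5) (xs!2) = E (xs!2) (xs!5)"
    "E (xs!5) (xs!3) = E (xs!3) (xs!5)" "E (xs!5) (xs!4) = E (xs!4) (xs!5)"
    by (rule sym)+
  have nths: "(a # as) ! 0 = a" "(a # b # as) ! 1 = b" "(a # b # c # as) ! 2 = c"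
    "(a # b # c # d # as) ! 3 = d" "(a # b # c # d # e # as) ! 4 = e"
    "(a # b # c # d # e # f # as) ! 5 = f" for a b c d e f :: 'a and as
    by simp_all
  have "(\<Sum>is\<leftarrow>splittings. tuple_form E (map ((!) xs) is)) =
      sym_form (E (xs!0) (xs!1)) (E (xs!0) (xs!2)) (E (xs!0) (xs!3)) (E (xs!0) (xs!4)) (E (xs!0) (xs!5))
        (E (xs!1) (xs!2)) (E (xs!1) (xs!3)) (E (xs!1) (xs!4)) (E (xs!1) (xs!5)) (E (xs!2) (xs!3))
        (E (xs!2) (xs!4)) (E (xs!2) (xs!5)) (E (xs!3) (xs!4)) (E (xs!3) (xs!5)) (E (xs!4) (xs!5))"
    unfolding splittings_def sym_form_def tuple_form_def
    by (simp only: list.map sum_list.Cons sum_list.Nil nths swap add_0_right ac_simps)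
  then show ?thesis by (simp add: sym_form_nonneg)
qed

text \<open>By permutation invariance each of the 45 splittings contributes the same total, so 45
  times the sum is a sum of nonnegative local terms. Tuples with repeated vertices are covered,
  because \<open>sym_form_nonneg\<close> ranges over all truth values of the fifteen pairs.\<close>

lemma sum_six_form_nonneg:
  fixes E :: "'a \<Rightarrow> 'a \<Rightarrow> bool"
  assumes "finite V" and sym: "\<And>x y. E x y = E y x"
  shows "0 \<le> (\<Sum>x\<in>V. \<Sum>y\<in>V. \<Sum>z\<in>V. \<Sum>u\<in>V. \<Sum>p\<in>V. \<Sum>q\<in>V.
    six_form (E x y) (E x z) (E x u) (E y z) (E y u) (E z u) (E x p) (E x q) (E y p) (E y q) (E p q))"
proof -
  let ?L = "{xs. set xs \<subseteq> V \<and> length xs = 6}"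
  have "0 \<le> (\<Sum>xs\<in>?L. \<Sum>is\<leftarrow>splittings. tuple_form E (map ((!) xs) is))"
    by (intro sum_nonneg sum_splittings_nonneg sym)
  also have "\<dots> = (\<Sum>is\<leftarrow>splittings. \<Sum>xs\<in>?L. tuple_form E (map ((!) xs) is))"
    by (rule sum_sum_list_swap)
  also have "\<dots> = (\<Sum>is\<leftarrow>splittings. \<Sum>xs\<in>?L. tuple_form E xs)"
    using assms(1) splittings_permute
    by (intro arg_cong[where f = sum_list] map_cong refl sum_lists_permute) auto
  also have "\<dots> = 45 * (\<Sum>xs\<in>?L. tuple_form E xs)"
    by (simp add: sum_list_triv length_splittings)
  finally have "0 \<le> (\<Sum>xs\<in>?L. tuple_form E xs)" by simp
  moreover have "6 = Suc (Suc (Suc (Suc (Suc (Suc 0)))))" by simp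
  ultimately show ?thesis
    using assms(1)
    by (simp only: sum_lists_length_Suc sum_lists_length_0) (simp add: tuple_form_def)
qed

section \<open>The bound on sums over quadruples\<close>

text \<open>With \<open>r\<close> and \<open>s\<close> independent, each product sums to a square,
  and each linear half picks up a factor \<open>card W\<close>.\<close>

lemma sum_flag_form:
  fixes f :: "'b \<Rightarrow> flag"
  shows "(\<Sum>r\<in>W. \<Sum>s\<in>W. flag_form (f r) (f s)) =
    916 * int (card W) * (\<Sum>r\<in>W. three_sign (f r)) - 916 * (\<Sum>r\<in>W. opp_sign (f r))\<^sup>2
    - 17 * (\<Sum>r\<in>W. lin0 (f r))\<^sup>2 - 8 * (\<Sum>r\<in>W. lin1 (f r))\<^sup>2 - 8 * (\<Sum>r\<in>W. lin2 (f r))\<^sup>2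
    - 42 * (\<Sum>r\<in>W. lin3 (f r))\<^sup>2 - (\<Sum>r\<in>W. odd_cycle (f r))\<^sup>2"
proof -
  have const: "(\<Sum>r\<in>W. \<Sum>s\<in>W. 458 * (three_sign (f r) + three_sign (f s))) =
      916 * int (card W) * (\<Sum>r\<in>W. three_sign (f r))"
    by (simp add: distrib_left sum.distrib flip: sum_distrib_left)
  have square: "(\<Sum>r\<in>W. \<Sum>s\<in>W. c * (h r * h s)) = c * (\<Sum>r\<in>W. h r)\<^sup>2"
    for c :: int and h :: "'b \<Rightarrow> int"
    by (simp add: power2_eq_square sum_product flip: sum_distrib_left)
  \<comment> \<open>The \<open>odd_cycle\<close> product carries no explicit weight in
    \<open>flag_form\<close>, so it needs a pattern without a factor.\<close>
  have square1: "(\<Sum>r\<in>W. \<Sum>s\<in>W. h r * h s) = (\<Sum>r\<in>W. h r)\<^sup>2" for h :: "'b \<Rightarrow> int"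
    by (simp add: power2_eq_square sum_product)
  show ?thesis
    unfolding flag_form_def
    by (simp only: sum_subtractf const square square1)
qed

definition edge_sign :: "bool \<Rightarrow> int" where
  "edge_sign b = (if b then 1 else - 1)"

text \<open>Here the table receives its meaning. A complement-invariant class can hold this
  information because the complement of three edges among six pairs again has three edges.\<close>

lemma three_sign_flag_of:
  "three_sign (flag_of xy xz xu yz yu zu) =
    (if of_bool xy + of_bool xz + of_bool xu + of_bool yz + of_bool yu + of_bool zu = (3 :: nat)
     then - 1 else 1)"
  by (cases xy; cases xz; cases xu; cases yz; cases yu; cases zu) (simp_all add: flag_of_def)

lemma opp_sign_flag_of:
  "opp_sign (flag_of xy xz xu yz yu zu) = edge_sign xy * edge_sign zu"
  by (cases xy; cases xz; cases xu; cases yz; cases yu; cases zu)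
     (simp_all add: flag_of_def edge_sign_def)

text \<open>The right-hand side says that the 4-cycle \<open>x z y u\<close> has an odd number of
  edges, that is, sign product -1.\<close>

lemma odd_cycle_flag_of:
  "odd_cycle (flag_of xy xz xu yz yu zu) = of_bool ((xz = xu) \<noteq> (yz = yu))"
  by (cases xy; cases xz; cases xu; cases yz; cases yu; cases zu) (simp_all add: flag_of_def)

definition three_edges :: "('a \<Rightarrow> 'a \<Rightarrow> bool) \<Rightarrow> 'a \<Rightarrow> 'a \<Rightarrow> 'a \<Rightarrow> 'a \<Rightarrow> bool" where
  "three_edges E x y z u \<longleftrightarrow>
    of_bool (E x y) + of_bool (E x z) + of_bool (E x u) + of_bool (E y z) + of_bool (E y u)
      + of_bool (E z u) = (3 :: nat)"

text \<open>For fixed \<open>x, y\<close>, \<open>sum_flag_form\<close> is applied to all pairs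
  \<open>(z, u)\<close>; summing over \<open>x, y\<close> makes the total of the forms nonnegative
  by \<open>sum_six_form_nonneg\<close>. Moving the two retained squares to the left gives the
  bound.\<close>

lemma three_edges_sum_bound:
  fixes E :: "'a \<Rightarrow> 'a \<Rightarrow> bool"
  assumes "finite V" and sym: "\<And>x y. E x y = E y x"
  defines "n \<equiv> int (card V)"
  shows "916 * n\<^sup>2 * (\<Sum>x\<in>V. \<Sum>y\<in>V. edge_sign (E x y))\<^sup>2
      + (\<Sum>x\<in>V. \<Sum>y\<in>V. (\<Sum>z\<in>V. \<Sum>u\<in>V. of_bool ((E x z = E x u) \<noteq> (E y z = E y u)))\<^sup>2)
    \<le> 916 * n\<^sup>2 * (\<Sum>x\<in>V. \<Sum>y\<in>V. \<Sum>z\<in>V. \<Sum>u\<in>V. if three_edges E x y z u then - 1 else 1)"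
proof -
  define f where "f x y r = flag_of (E x y) (E x (fst r)) (E x (snd r)) (E y (fst r)) (E y (snd r))
    (E (fst r) (snd r))" for x y r
  define D where "D = (\<Sum>x\<in>V. \<Sum>y\<in>V. edge_sign (E x y))"
  let ?S = "\<lambda>x y. \<Sum>z\<in>V. \<Sum>u\<in>V. if three_edges E x y z u then - 1 else (1 :: int)"
  let ?O = "\<lambda>x y. \<Sum>z\<in>V. \<Sum>u\<in>V. of_bool ((E x z = E x u) \<noteq> (E y z = E y u)) :: int"
  have card: "int (card (V \<times> V)) = n\<^sup>2"
    by (simp add: n_def power2_eq_square card_cartesian_product)
  have S: "(\<Sum>r\<in>V\<times>V. three_sign (f x y r)) = ?S x y" for x y
    by (simp add: f_def three_sign_flag_of three_edges_def sum.cartesian_product case_prod_beta)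
  have K: "(\<Sum>r\<in>V\<times>V. opp_sign (f x y r)) = edge_sign (E x y) * D" for x y
    by (simp add: f_def opp_sign_flag_of D_def sum.cartesian_product case_prod_beta sum_distrib_left)
  have O: "(\<Sum>r\<in>V\<times>V. odd_cycle (f x y r)) = ?O x y" for x y
    by (simp add: f_def odd_cycle_flag_of sum.cartesian_product case_prod_beta)
  have pair: "(\<Sum>r\<in>V\<times>V. \<Sum>s\<in>V\<times>V. flag_form (f x y r) (f x y s))
      \<le> 916 * n\<^sup>2 * ?S x y - 916 * D\<^sup>2 - (?O x y)\<^sup>2" for x y
  proof -
    \<comment> \<open>The sign of \<open>xy\<close> vanishes on squaring, so each of the
      \<open>n * n\<close> pairs contributes the same square of \<open>D\<close>.\<close>
    have "(edge_sign (E x y) * D)\<^sup>2 = D\<^sup>2"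
      by (simp add: edge_sign_def)
    \<comment> \<open>The squares of \<open>lin0\<close> to \<open>lin3\<close> are discarded
      here.\<close>
    then show ?thesis
      unfolding sum_flag_form card S K O
      using zero_le_power2[of "\<Sum>r\<in>V\<times>V. lin0 (f x y r)"]
        zero_le_power2[of "\<Sum>r\<in>V\<times>V. lin1 (f x y r)"]
        zero_le_power2[of "\<Sum>r\<in>V\<times>V. lin2 (f x y r)"]
        zero_le_power2[of "\<Sum>r\<in>V\<times>V. lin3 (f x y r)"]
      by linarith
  qed
  have "0 \<le> (\<Sum>x\<in>V. \<Sum>y\<in>V. \<Sum>z\<in>V. \<Sum>u\<in>V. \<Sum>p\<in>V. \<Sum>q\<in>V.
      flag_form (f x y (z, u)) (f x y (p, q)))"
    using sum_six_form_nonneg[OF assms(1,2)] by (simp add: f_def six_form_def)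
  also have "\<dots> = (\<Sum>x\<in>V. \<Sum>y\<in>V. \<Sum>r\<in>V\<times>V. \<Sum>s\<in>V\<times>V. flag_form (f x y r) (f x y s))"
    by (simp add: sum.cartesian_product')
  also have "\<dots> \<le> (\<Sum>x\<in>V. \<Sum>y\<in>V. 916 * n\<^sup>2 * ?S x y - 916 * D\<^sup>2 - (?O x y)\<^sup>2)"
    by (intro sum_mono pair)
  also have "\<dots> = 916 * n\<^sup>2 * (\<Sum>x\<in>V. \<Sum>y\<in>V. ?S x y) - n * (n * (916 * D\<^sup>2))
      - (\<Sum>x\<in>V. \<Sum>y\<in>V. (?O x y)\<^sup>2)"
    by (simp add: sum_subtractf n_def flip: sum_distrib_left)
  finally show ?thesis
    unfolding D_def[symmetric] by (simp add: power2_eq_square algebra_simps)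
qed

section \<open>Four-vertex subsets and ordered quadruples\<close>

definition adjacent :: "'a graph \<Rightarrow> 'a \<Rightarrow> 'a \<Rightarrow> bool" where
  "adjacent G x y \<longleftrightarrow> {x, y} \<in> edges G"

lemma adjacent_commute: "adjacent G x y = adjacent G y x"
  by (simp add: adjacent_def insert_commute)

lemma three_edges_iff_card:
  assumes "simple_graph G" and "distinct [x, y, z, u]"
  shows "three_edges (adjacent G) x y z u \<longleftrightarrow> card {e \<in> edges G. e \<subseteq> {x, y, z, u}} = 3"
proof -
  let ?ps = "[{x, y}, {x, z}, {x, u}, {y, z}, {y, u}, {z, u}]"
  have "e \<in> set ?ps" if "e \<in> edges G" "e \<subseteq> {x, y, z, u}" for e
  proof -
    have "card e = 2" using assms(1) that(1) by (auto simp: simple_graph_def)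
    then obtain p q where "e = {p, q}" "p \<noteq> q" by (auto simp: card_2_iff)
    moreover from this have "p \<in> {x, y, z, u}" "q \<in> {x, y, z, u}" using that(2) by auto
    ultimately show ?thesis by (elim insertE emptyE) (simp_all add: insert_commute)
  qed
  moreover have "e \<subseteq> {x, y, z, u}" if "e \<in> set ?ps" for e
    using that by (auto simp only: set_simps insert_iff empty_iff)
  ultimately have "{e \<in> edges G. e \<subseteq> {x, y, z, u}} = set (filter (\<lambda>e. e \<in> edges G) ?ps)"
    unfolding set_filter by blast
  moreover have "distinct (filter (\<lambda>e. e \<in> edges G) ?ps)"
    using assms(2) by (intro distinct_filter) (simp add: doubleton_eq_iff)
  ultimately have "card {e \<in> edges G. e \<subseteq> {x, y, z, u}} = length (filter (\<lambda>e. e \<in> edges G) ?ps)"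
    by (simp only: distinct_card)
  moreover have "length (filter P xs) = (\<Sum>x\<leftarrow>xs. of_bool (P x))" for P and xs :: "'a set list"
    by (induction xs) simp_all
  ultimately show ?thesis
    by (simp only: three_edges_def adjacent_def list.map sum_list.Cons sum_list.Nil add_0_right add.assoc)
qed

text \<open>Each 4-set has 4! = 24 orderings, and different sets have different ones. Only an
  inequality holds, since quadruples with a repeated vertex may also satisfy
  \<open>three_edges\<close>.\<close>

lemma card_three_edges_tuples:
  assumes G: "simple_graph G"
  defines "V \<equiv> verts G"
  shows "24 * card {X. X \<subseteq> V \<and> card X = 4 \<and> card {e \<in> edges G. e \<subseteq> X} = 3}
    \<le> card {(x, y, z, u). (x, y, z, u) \<in> V \<times> V \<times> V \<times> V \<and> three_edges (adjacent G) x y z u}"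
    (is "24 * card ?F \<le> card ?B")
proof -
  have fin: "finite V" using G by (simp add: simple_graph_def V_def)
  let ?L = "\<lambda>X. {xs. length xs = 4 \<and> distinct xs \<and> set xs \<subseteq> X}"
  have finF: "finite ?F" using fin by simp
  have X: "finite X" "card X = 4" if "X \<in> ?F" for X
    using that by (simp_all add: finite_subset[OF _ fin])
  have set_eq: "set xs = X" if "X \<in> ?F" "xs \<in> ?L X" for X xs
    using that X[OF that(1)] by (intro card_subset_eq) (simp_all add: distinct_card)
  have "card (\<Union>X\<in>?F. ?L X) = (\<Sum>X\<in>?F. card (?L X))"
  proof (rule card_UN_disjoint[OF finF])
    show "\<forall>X\<in>?F. finite (?L X)"
    proof
      fix X assume "X \<in> ?F"
      then have "finite {xs. set xs \<subseteq> X \<and> length xs = 4}"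
        using finite_lists_length_eq[OF X(1)] by blast
      then show "finite (?L X)" by (rule rev_finite_subset) auto
    qed
    show "\<forall>X\<in>?F. \<forall>Y\<in>?F. X \<noteq> Y \<longrightarrow> ?L X \<inter> ?L Y = {}"
    proof (intro ballI impI equals0I)
      fix X Y xs assume *: "X \<in> ?F" "Y \<in> ?F" "X \<noteq> Y" "xs \<in> ?L X \<inter> ?L Y"
      have "X = Y"
        using set_eq[OF *(1) IntD1[OF *(4)]] set_eq[OF *(2) IntD2[OF *(4)]] by (rule trans[OF sym])
      then show False using *(3) by contradiction
    qed
  qed
  also have "\<dots> = (\<Sum>X\<in>?F. 24)"
  proof (rule sum.cong[OF refl])
    fix X assume "X \<in> ?F"
    note X = X[OF this]
    have "card (?L X) = \<Prod>{1..4}"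
      using card_lists_distinct_length_eq[OF X(1), of 4] X(2) by simp
    also have "\<dots> = fact 4" by (simp only: fact_prod of_nat_id)
    also have "\<dots> = (24 :: nat)" by (simp add: fact_numeral)
    finally show "card (?L X) = 24" .
  qed
  finally have card: "card (\<Union>X\<in>?F. ?L X) = 24 * card ?F" by simp
  have finB: "finite ?B"
    by (rule finite_subset[of _ "V \<times> V \<times> V \<times> V"]) (use fin in auto)
  have "(\<Union>X\<in>?F. ?L X) \<subseteq> (\<lambda>(x, y, z, u). [x, y, z, u]) ` ?B"
  proof
    fix xs assume "xs \<in> (\<Union>X\<in>?F. ?L X)"
    then obtain X where X: "X \<in> ?F" "xs \<in> ?L X" by blast
    then have "length xs = Suc (Suc (Suc (Suc 0)))" by simp
    then obtain x y z u where xs: "xs = [x, y, z, u]"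
      unfolding length_Suc_conv length_0_conv by blast
    then have X': "X = {x, y, z, u}" using set_eq[OF X] by simp
    have "card {e \<in> edges G. e \<subseteq> {x, y, z, u}} = 3" "{x, y, z, u} \<subseteq> V"
      using X(1) unfolding X' mem_Collect_eq by blast+
    then have "(x, y, z, u) \<in> ?B"
      using three_edges_iff_card[OF G, of x y z u] X(2) xs by simp
    then show "xs \<in> (\<lambda>(x, y, z, u). [x, y, z, u]) ` ?B"
      unfolding image_iff by (rule bexI[rotated]) (simp add: xs)
  qed
  then have "card (\<Union>X\<in>?F. ?L X) \<le> card ?B"
    using finB by (rule surj_card_le[rotated])
  then show ?thesis using card by simp
qed

lemma sum_three_edges_sign:
  assumes "finite V"
  shows "(\<Sum>x\<in>V. \<Sum>y\<in>V. \<Sum>z\<in>V. \<Sum>u\<in>V. if three_edges E x y z u then - 1 else (1 :: int)) =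
    int (card V) ^ 4
    - 2 * int (card {(x, y, z, u). (x, y, z, u) \<in> V \<times> V \<times> V \<times> V \<and> three_edges E x y z u})"
    (is "?lhs = _ - 2 * int (card ?B)")
proof -
  let ?W = "V \<times> V \<times> V \<times> V"
  have B: "?B = ?W \<inter> {(x, y, z, u). three_edges E x y z u}" by auto
  have "?lhs = (\<Sum>(x, y, z, u)\<in>?W. 1 - 2 * of_bool (three_edges E x y z u))"
    unfolding sum.cartesian_product' split_conv by (intro sum.cong refl) simp
  also have "\<dots> = int (card ?W) - 2 * (\<Sum>(x, y, z, u)\<in>?W. of_bool (three_edges E x y z u))"
    by (simp add: case_prod_beta sum_subtractf flip: sum_distrib_left)
  also have "(\<Sum>(x, y, z, u)\<in>?W. of_bool (three_edges E x y z u)) = int (card ?B)"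
    using assms unfolding B
    by (simp add: case_prod_beta' of_bool_def sum.If_cases)
  finally show ?thesis
    by (simp add: card_cartesian_product power_numeral_reduce)
qed

lemma fourth_power_le_choose_4:
  assumes "n \<ge> 4"
  shows "real n ^ 4 - 6 * real n ^ 3 \<le> 24 * real (n choose 4)"
proof -
  have "24 * real (n choose 4) = real n * (real n - 1) * (real n - 2) * (real n - 3)"
    using assms by (simp add: binomial_gbinomial gbinomial_prod_rev fact_numeral
        atLeast0_lessThan_Suc eval_nat_numeral field_simps)
  also have "\<dots> = real n ^ 4 - 6 * real n ^ 3 + real n * (11 * real n - 6)"
    by algebra
  finally show ?thesis using assms by simp
qed

text \<open>The sum is \<open>n^4\<close> minus twice the number of three-edge quadruples, which the
  density bounds below by \<open>(1/2 - \<delta>) (n^4 - 6 n^3)\<close>. This leaves at most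
  \<open>2 \<delta> n^4 + 6 n^3\<close>, and \<open>n \<ge> 6 / \<delta>\<close> turns the cubic
  term into a third \<open>\<delta> n^4\<close>.\<close>

lemma sum_three_edges_sign_le:
  fixes G :: "'a graph" and \<delta> :: real
  assumes G: "simple_graph G" and \<delta>: "0 < \<delta>" "\<delta> \<le> 1 / 2"
    and n: "n = card (verts G)" "4 \<le> n" "6 / \<delta> \<le> real n"
    and dens: "1 / 2 - \<delta> \<le> edge_inducibility_density 4 3 G"
  defines "V \<equiv> verts G"
  shows "real_of_int (\<Sum>x\<in>V. \<Sum>y\<in>V. \<Sum>z\<in>V. \<Sum>u\<in>V. if three_edges (adjacent G) x y z u then - 1 else 1)
    \<le> 3 * \<delta> * real n ^ 4"
proof -
  let ?f = "real (card {X. X \<subseteq> V \<and> card X = 4 \<and> card {e \<in> edges G. e \<subseteq> X} = 3})"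
  let ?b = "real (card {(x, y, z, u). (x, y, z, u) \<in> V \<times> V \<times> V \<times> V
    \<and> three_edges (adjacent G) x y z u})"
  have fin: "finite V" using G by (simp add: simple_graph_def V_def)
  have pos: "0 < real (n choose 4)" using n(2) by simp
  have "(1 / 2 - \<delta>) * (real n ^ 4 - 6 * real n ^ 3) \<le> (1 / 2 - \<delta>) * (24 * real (n choose 4))"
    using \<delta> fourth_power_le_choose_4[OF n(2)] by (intro mult_left_mono) auto
  also have "\<dots> \<le> 24 * ?f"
  proof -
    have "(1 / 2 - \<delta>) * real (n choose 4) \<le> ?f"
      using dens pos unfolding edge_inducibility_density_def V_def n(1) by (simp only: pos_le_divide_eq)
    then show ?thesis by linarith
  qed
  also have "\<dots> \<le> ?b"
    using of_nat_mono[OF card_three_edges_tuples[OF G], where 'a = real] unfolding V_def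
    by (simp only: of_nat_mult of_nat_numeral)
  finally have b: "(1 / 2 - \<delta>) * (real n ^ 4 - 6 * real n ^ 3) \<le> ?b" .
  have "6 * real n ^ 3 \<le> \<delta> * real n * real n ^ 3"
    using n(3) \<delta>(1) by (intro mult_right_mono) (simp_all add: pos_divide_le_eq mult.commute)
  also have "\<dots> = \<delta> * real n ^ 4" by (simp add: power_numeral_reduce)
  finally have six: "6 * real n ^ 3 \<le> \<delta> * real n ^ 4" .
  have "real n ^ 4 - 2 * ?b \<le> real n ^ 4 - 2 * ((1 / 2 - \<delta>) * (real n ^ 4 - 6 * real n ^ 3))"
    using b by simp
  also have "\<dots> = 2 * \<delta> * real n ^ 4 + (1 - 2 * \<delta>) * (6 * real n ^ 3)"
    by (simp add: algebra_simps)
  also have "\<dots> \<le> 2 * \<delta> * real n ^ 4 + 1 * (6 * real n ^ 3)"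
    using \<delta> by (intro add_left_mono mult_right_mono) auto
  also have "\<dots> \<le> 3 * \<delta> * real n ^ 4" using six by simp
  finally show ?thesis
    using sum_three_edges_sign[OF fin, of "adjacent G"] by (simp add: V_def n(1))
qed

section \<open>Consequences of near-extremality\<close>

text \<open>Each retained square is at most \<open>916 n^2 S\<close>, where
  \<open>S \<le> 3 \<delta> n^4\<close>. The fourth power in \<open>\<delta>\<close> pays for two
  square roots: one here, leaving \<open>\<beta>^2\<close>, and one later, when the sizes of the two
  sides are compared.\<close>

lemma edge_sum_and_odd_cycles_small:
  fixes G :: "'a graph" and \<beta> :: real
  assumes G: "simple_graph G" and \<beta>: "0 < \<beta>" "\<beta> \<le> 1"
    and \<delta>: "\<delta> = \<beta> ^ 4 / 3000"
    and n: "n = card (verts G)" "4 \<le> n" "6 / \<delta> \<le> real n"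
    and dens: "1 / 2 - \<delta> \<le> edge_inducibility_density 4 3 G"
  defines "V \<equiv> verts G" and "E \<equiv> adjacent G"
  shows "\<bar>real_of_int (\<Sum>x\<in>V. \<Sum>y\<in>V. edge_sign (E x y))\<bar> \<le> \<beta>\<^sup>2 * real n ^ 2"
    and "(\<Sum>x\<in>V. \<Sum>y\<in>V. \<Sum>z\<in>V. \<Sum>u\<in>V. of_bool ((E x z = E x u) \<noteq> (E y z = E y u)))
      \<le> \<beta>\<^sup>2 * real n ^ 4"
proof -
  define D where "D = (\<Sum>x\<in>V. \<Sum>y\<in>V. edge_sign (E x y))"
  define Q where "Q x y = (\<Sum>z\<in>V. \<Sum>u\<in>V. of_bool ((E x z = E x u) \<noteq> (E y z = E y u)) :: int)" for x y
  define S where "S = (\<Sum>x\<in>V. \<Sum>y\<in>V. \<Sum>z\<in>V. \<Sum>u\<in>V. if three_edges E x y z u then - 1 else (1 :: int))"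
  have fin: "finite V" using G by (simp add: simple_graph_def V_def)
  have "\<beta> ^ 4 \<le> 1" using \<beta> by (simp add: power_le_one)
  then have \<delta>01: "0 < \<delta>" "\<delta> \<le> 1 / 2" using \<beta> by (simp_all add: \<delta>)
  have n0: "0 < real n" using n(2) by simp
  have S: "real_of_int S \<le> 3 * \<delta> * real n ^ 4"
    unfolding S_def V_def E_def by (rule sum_three_edges_sign_le[OF G \<delta>01 n dens])
  have "916 * (int n)\<^sup>2 * D\<^sup>2 + (\<Sum>x\<in>V. \<Sum>y\<in>V. (Q x y)\<^sup>2) \<le> 916 * (int n)\<^sup>2 * S"
    using three_edges_sum_bound[OF fin, of E]
    by (simp add: D_def Q_def S_def n(1) V_def E_def adjacent_commute)
  then have "real_of_int (916 * (int n)\<^sup>2 * D\<^sup>2 + (\<Sum>x\<in>V. \<Sum>y\<in>V. (Q x y)\<^sup>2))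
      \<le> real_of_int (916 * (int n)\<^sup>2 * S)"
    by (simp only: of_int_le_iff)
  then have main: "916 * real n ^ 2 * (real_of_int D)\<^sup>2 + (\<Sum>x\<in>V. \<Sum>y\<in>V. (real_of_int (Q x y))\<^sup>2)
      \<le> 916 * real n ^ 2 * real_of_int S"
    by simp
  have "0 \<le> (\<Sum>x\<in>V. \<Sum>y\<in>V. (real_of_int (Q x y))\<^sup>2)"
    by (intro sum_nonneg) simp
  then have "916 * real n ^ 2 * (real_of_int D)\<^sup>2 \<le> 916 * real n ^ 2 * real_of_int S"
    using main by linarith
  then have "(real_of_int D)\<^sup>2 \<le> real_of_int S"
    using n0 by (simp add: mult_le_cancel_left)
  also have "\<dots> \<le> \<beta> ^ 4 * real n ^ 4"
    using S by (rule order_trans) (intro mult_right_mono, use \<beta> in \<open>auto simp: \<delta>\<close>)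
  also have "\<dots> = (\<beta>\<^sup>2 * real n ^ 2)\<^sup>2"
    by (simp add: power_mult_distrib flip: power_mult)
  finally show "\<bar>real_of_int (\<Sum>x\<in>V. \<Sum>y\<in>V. edge_sign (E x y))\<bar> \<le> \<beta>\<^sup>2 * real n ^ 2"
    unfolding D_def by (metis abs_le_square_iff abs_of_nonneg mult_nonneg_nonneg zero_le_power2)
  \<comment> \<open>Cauchy-Schwarz over the \<open>n^2\<close> pairs passes from the squares of the
    counts to the counts themselves.\<close>
  have "(\<Sum>r\<in>V\<times>V. real_of_int (Q (fst r) (snd r)))\<^sup>2
      \<le> (\<Sum>r\<in>V\<times>V. (real_of_int (Q (fst r) (snd r)))\<^sup>2) * real (card (V \<times> V))"
    by (rule sum_squared_le_sum_of_squares)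
  then have "(\<Sum>x\<in>V. \<Sum>y\<in>V. real_of_int (Q x y))\<^sup>2
      \<le> (\<Sum>x\<in>V. \<Sum>y\<in>V. (real_of_int (Q x y))\<^sup>2) * real n ^ 2"
    by (simp add: sum.cartesian_product' card_cartesian_product n(1) V_def power2_eq_square)
  also have "\<dots> \<le> 916 * real n ^ 2 * real_of_int S * real n ^ 2"
  proof (rule mult_right_mono)
    have "0 \<le> 916 * real n ^ 2 * (real_of_int D)\<^sup>2" by simp
    then show "(\<Sum>x\<in>V. \<Sum>y\<in>V. (real_of_int (Q x y))\<^sup>2) \<le> 916 * real n ^ 2 * real_of_int S"
      using main by linarith
  qed simp
  also have "\<dots> \<le> 916 * real n ^ 2 * (3 * \<delta> * real n ^ 4) * real n ^ 2"
    using S by (intro mult_right_mono mult_left_mono) auto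
  \<comment> \<open>2748 = 916 * 3; the 3000 in \<open>\<delta>\<close> is a round number above
    it.\<close>
  also have "\<dots> = (2748 / 3000) * (\<beta> ^ 4 * real n ^ 8)"
    by (simp add: \<delta> flip: power_add)
  also have "\<dots> \<le> 1 * (\<beta> ^ 4 * real n ^ 8)"
    by (intro mult_right_mono) auto
  also have "\<dots> = (\<beta>\<^sup>2 * real n ^ 4)\<^sup>2"
    by (simp add: power_mult_distrib flip: power_mult)
  finally have "(\<Sum>x\<in>V. \<Sum>y\<in>V. real_of_int (Q x y)) \<le> \<beta>\<^sup>2 * real n ^ 4"
    by (rule power2_le_imp_le) simp
  then show "(\<Sum>x\<in>V. \<Sum>y\<in>V. \<Sum>z\<in>V. \<Sum>u\<in>V. of_bool ((E x z = E x u) \<noteq> (E y z = E y u)))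
      \<le> \<beta>\<^sup>2 * real n ^ 4"
    by (simp add: Q_def)
qed

section \<open>The two-block structure\<close>

lemma sum_of_bool_eq_card:
  assumes "finite V"
  shows "(\<Sum>x\<in>V. \<Sum>z\<in>V. of_bool (P x z)) = real (card {r \<in> V \<times> V. P (fst r) (snd r)})"
proof -
  have "(\<Sum>x\<in>V. \<Sum>z\<in>V. of_bool (P x z)) = (\<Sum>r\<in>V\<times>V. of_bool (P (fst r) (snd r)) :: real)"
    by (simp add: sum.cartesian_product')
  also have "\<dots> = real (card ((V \<times> V) \<inter> {r. P (fst r) (snd r)}))"
    using assms by (simp add: of_bool_def sum.If_cases)
  also have "(V \<times> V) \<inter> {r. P (fst r) (snd r)} = {r \<in> V \<times> V. P (fst r) (snd r)}" by blast
  finally show ?thesis .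
qed

text \<open>Averaging: if every choice of \<open>y, u\<close> exceeded the bound, summing over all
  \<open>n^2\<close> choices would contradict \<open>odd\<close>.\<close>

lemma ex_few_odd_cycles:
  fixes \<theta> :: real
  assumes "finite V" "V \<noteq> {}"
    and odd: "(\<Sum>x\<in>V. \<Sum>y\<in>V. \<Sum>z\<in>V. \<Sum>u\<in>V. of_bool ((E x z = E x u) \<noteq> (E y z = E y u)))
      \<le> \<theta> * real (card V) ^ 4"
  shows "\<exists>y\<in>V. \<exists>u\<in>V. real (card {r \<in> V \<times> V.
    (E (fst r) (snd r) = E (fst r) u) \<noteq> (E y (snd r) = E y u)}) \<le> \<theta> * real (card V) ^ 2"
proof (rule ccontr)
  let ?n = "real (card V)"
  let ?h = "\<lambda>y u. real (card {r \<in> V \<times> V. (E (fst r) (snd r) = E (fst r) u) \<noteq> (E y (snd r) = E y u)})"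
  assume neg: "\<not> ?thesis"
  have "\<theta> * ?n ^ 4 = (\<Sum>r\<in>V\<times>V. \<theta> * ?n ^ 2)"
    by (simp add: card_cartesian_product power_numeral_reduce)
  also have "\<dots> < (\<Sum>r\<in>V\<times>V. ?h (fst r) (snd r))"
    using neg assms(1,2) by (intro sum_strict_mono) (auto simp: not_le)
  also have "\<dots> = (\<Sum>y\<in>V. \<Sum>u\<in>V. \<Sum>x\<in>V. \<Sum>z\<in>V. of_bool ((E x z = E x u) \<noteq> (E y z = E y u)))"
    by (simp only: sum.cartesian_product' fst_conv snd_conv sum_of_bool_eq_card[OF assms(1)])
  also have "\<dots> = (\<Sum>y\<in>V. \<Sum>x\<in>V. \<Sum>u\<in>V. \<Sum>z\<in>V. of_bool ((E x z = E x u) \<noteq> (E y z = E y u)))"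
    by (rule sum.cong[OF refl], rule sum.swap)
  also have "\<dots> = (\<Sum>y\<in>V. \<Sum>x\<in>V. \<Sum>z\<in>V. \<Sum>u\<in>V. of_bool ((E x z = E x u) \<noteq> (E y z = E y u)))"
    by (rule sum.cong[OF refl], rule sum.cong[OF refl], rule sum.swap)
  also have "\<dots> = (\<Sum>x\<in>V. \<Sum>y\<in>V. \<Sum>z\<in>V. \<Sum>u\<in>V. of_bool ((E x z = E x u) \<noteq> (E y z = E y u)))"
    by (rule sum.swap)
  also have "\<dots> \<le> \<theta> * ?n ^ 4" by (rule odd)
  finally show False by simp
qed

text \<open>Off a small set, \<open>E x z\<close> has the product form \<open>a x = b z\<close>.
  Symmetry of \<open>E\<close> then forces \<open>b\<close> to agree with \<open>a\<close>, or with
  its negation, at almost all vertices; \<open>s\<close> records which. Edges lie inside the blocks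
  if \<open>s\<close> holds and between them otherwise.\<close>

lemma two_block_structure:
  fixes E :: "'a \<Rightarrow> 'a \<Rightarrow> bool" and \<theta> :: real
  assumes fin: "finite V" and ne: "V \<noteq> {}" and sym: "\<And>x y. E x y = E y x"
    and odd: "(\<Sum>x\<in>V. \<Sum>y\<in>V. \<Sum>z\<in>V. \<Sum>u\<in>V. of_bool ((E x z = E x u) \<noteq> (E y z = E y u)))
      \<le> \<theta> * real (card V) ^ 4"
  obtains a :: "'a \<Rightarrow> bool" and s where "real (card {r \<in> V \<times> V.
    E (fst r) (snd r) \<noteq> ((a (fst r) = a (snd r)) = s)}) \<le> 3 * \<theta> * real (card V) ^ 2"
proof -
  define n where "n = real (card V)"
  have n: "0 < n" using fin ne by (simp add: n_def card_gt_0_iff)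
  obtain y u where yu: "real (card {r \<in> V \<times> V.
      (E (fst r) (snd r) = E (fst r) u) \<noteq> (E y (snd r) = E y u)}) \<le> \<theta> * n ^ 2"
    using ex_few_odd_cycles[OF fin ne odd] unfolding n_def by blast
  \<comment> \<open>An even cycle \<open>x z y u\<close> means exactly
    \<open>E x z = (a x = b z)\<close>, by parity.\<close>
  define a where "a x = E x u" for x
  define b where "b z = (E y z = E y u)" for z
  define bad where "bad = {r \<in> V \<times> V. E (fst r) (snd r) \<noteq> (a (fst r) = b (snd r))}"
  have "{r \<in> V \<times> V. (E (fst r) (snd r) = E (fst r) u) \<noteq> (E y (snd r) = E y u)} = bad"
    unfolding bad_def a_def b_def by blast
  then have bad: "real (card bad) \<le> \<theta> * n ^ 2" using yu by simp
  have finbad: "finite bad" using fin by (simp add: bad_def)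
  define g where "g x = (a x = b x)" for x
  \<comment> \<open>\<open>s\<close> is the majority value of \<open>g\<close>, so the exceptional
    set \<open>R\<close> contains at most half of the vertices.\<close>
  define s where "s \<longleftrightarrow> card {x \<in> V. \<not> g x} \<le> card {x \<in> V. g x}"
  define R where "R = {x \<in> V. g x \<noteq> s}"
  have finR: "finite R" "R \<subseteq> V" using fin by (auto simp: R_def)
  have "R = (if s then {x \<in> V. \<not> g x} else {x \<in> V. g x})"
    "V - R = (if s then {x \<in> V. g x} else {x \<in> V. \<not> g x})"
    by (auto simp: R_def)
  then have "card R \<le> card (V - R)" by (auto simp: s_def)
  moreover have "card R + card (V - R) = card V"
    using finR fin by (metis card_Diff_subset card_mono le_add_diff_inverse)
  ultimately have half: "n \<le> 2 * real (card (V - R))" unfolding n_def by linarith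
  \<comment> \<open>If \<open>g\<close> differs at two vertices, the product form predicts different
    values for the two orders of the pair, so by symmetry of \<open>E\<close> one order is
    bad.\<close>
  have "R \<times> (V - R) \<union> (V - R) \<times> R \<subseteq> bad \<union> prod.swap ` bad"
  proof
    fix r assume "r \<in> R \<times> (V - R) \<union> (V - R) \<times> R"
    then have r: "fst r \<in> V" "snd r \<in> V" "g (fst r) \<noteq> g (snd r)"
      by (auto simp: R_def)
    then have "(a (fst r) = b (snd r)) \<noteq> (a (snd r) = b (fst r))"
      unfolding g_def by blast
    then have "r \<in> bad \<or> prod.swap r \<in> bad"
      using r sym[of "fst r" "snd r"] by (auto simp: bad_def mem_Times_iff)
    then show "r \<in> bad \<union> prod.swap ` bad"
      by (metis UnCI image_eqI swap_swap)
  qed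
  then have "card (R \<times> (V - R) \<union> (V - R) \<times> R) \<le> card (bad \<union> prod.swap ` bad)"
    using finbad by (intro card_mono) auto
  also have "\<dots> \<le> card bad + card bad"
    by (rule order_trans[OF card_Un_le]) (simp add: card_image_le[OF finbad])
  also have "card (R \<times> (V - R) \<union> (V - R) \<times> R) = 2 * (card R * card (V - R))"
    using finR fin by (subst card_Un_disjoint) (auto simp: card_cartesian_product)
  finally have "card R * card (V - R) \<le> card bad" by simp
  then have "real (card R) * real (card (V - R)) \<le> real (card bad)"
    unfolding of_nat_mult[symmetric] by (rule of_nat_mono)
  then have "real (card R) * real (card (V - R)) \<le> \<theta> * n ^ 2" using bad by linarith
  moreover have "real (card R) * n \<le> real (card R) * (2 * real (card (V - R)))"
    using half by (intro mult_left_mono) auto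
  ultimately have "real (card R) * n \<le> (2 * \<theta> * n) * n" by (simp add: power2_eq_square)
  then have cardR: "real (card R) \<le> 2 * \<theta> * n" using n by simp
  \<comment> \<open>Replacing \<open>b\<close> by \<open>a\<close> or its negation costs only pairs
    with second entry in \<open>R\<close>, at most \<open>2 \<theta> n^2\<close> of them.\<close>
  have sub: "{r \<in> V \<times> V. E (fst r) (snd r) \<noteq> ((a (fst r) = a (snd r)) = s)} \<subseteq> bad \<union> V \<times> R"
  proof
    fix r assume r: "r \<in> {r \<in> V \<times> V. E (fst r) (snd r) \<noteq> ((a (fst r) = a (snd r)) = s)}"
    show "r \<in> bad \<union> V \<times> R"
    proof (cases "snd r \<in> R")
      case False
      then have "(a (snd r) = b (snd r)) = s" using r by (auto simp: R_def g_def mem_Times_iff)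
      then have "E (fst r) (snd r) \<noteq> (a (fst r) = b (snd r))" using r by auto
      then show ?thesis using r by (simp add: bad_def)
    qed (use r in \<open>auto simp: mem_Times_iff\<close>)
  qed
  have "card {r \<in> V \<times> V. E (fst r) (snd r) \<noteq> ((a (fst r) = a (snd r)) = s)} \<le> card (bad \<union> V \<times> R)"
    using finbad fin finR by (intro card_mono[OF _ sub]) simp
  also have "\<dots> \<le> card bad + card V * card R"
    by (rule order_trans[OF card_Un_le]) (simp add: card_cartesian_product)
  finally have "real (card {r \<in> V \<times> V. E (fst r) (snd r) \<noteq> ((a (fst r) = a (snd r)) = s)})
      \<le> real (card bad + card V * card R)"
    by (rule of_nat_mono)
  also have "\<dots> = real (card bad) + n * real (card R)" by (simp add: n_def)
  also have "\<dots> \<le> \<theta> * n ^ 2 + n * (2 * \<theta> * n)"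
    using bad cardR n by (intro add_mono mult_left_mono) auto
  also have "\<dots> = 3 * \<theta> * n ^ 2" by (simp add: power2_eq_square)
  finally show thesis unfolding n_def by (rule that)
qed

text \<open>Passing to the block model changes an entry by 2 on bad pairs only, hence the total by
  at most \<open>6 \<theta> n^2\<close>. The model total is plus or minus the square of the sum of
  the signs of \<open>a\<close>, so that square is at most
  \<open>(1 + 6) \<theta> n^2\<close>.\<close>

lemma block_balance:
  fixes \<theta> :: real
  assumes fin: "finite V"
    and total: "\<bar>real_of_int (\<Sum>x\<in>V. \<Sum>z\<in>V. edge_sign (E x z))\<bar> \<le> \<theta> * real (card V) ^ 2"
    and bad: "real (card {r \<in> V \<times> V. E (fst r) (snd r) \<noteq> ((a (fst r) = a (snd r)) = s)})
      \<le> 3 * \<theta> * real (card V) ^ 2"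
  shows "(real_of_int (\<Sum>x\<in>V. edge_sign (a x)))\<^sup>2 \<le> 7 * \<theta> * real (card V) ^ 2"
proof -
  define w where "w x z = edge_sign (E x z) - edge_sign s * (edge_sign (a x) * edge_sign (a z))" for x z
  have w: "\<bar>w x z\<bar> = 2 * of_bool (E x z \<noteq> ((a x = a z) = s))" for x z
    by (cases "E x z"; cases "a x"; cases "a z"; cases s) (simp_all add: w_def edge_sign_def)
  have "\<bar>\<Sum>x\<in>V. \<Sum>z\<in>V. w x z\<bar> \<le> (\<Sum>x\<in>V. \<Sum>z\<in>V. \<bar>w x z\<bar>)"
    by (rule order_trans[OF sum_abs]) (intro sum_mono sum_abs)
  then have "real_of_int \<bar>\<Sum>x\<in>V. \<Sum>z\<in>V. w x z\<bar> \<le> real_of_int (\<Sum>x\<in>V. \<Sum>z\<in>V. \<bar>w x z\<bar>)"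
    by (simp only: of_int_le_iff)
  also have "\<dots> = 2 * (\<Sum>x\<in>V. \<Sum>z\<in>V. of_bool (E x z \<noteq> ((a x = a z) = s)))"
    by (simp add: w flip: sum_distrib_left)
  also have "\<dots> \<le> 6 * \<theta> * real (card V) ^ 2"
    using bad by (simp add: sum_of_bool_eq_card[OF fin])
  finally have diff: "\<bar>real_of_int (\<Sum>x\<in>V. \<Sum>z\<in>V. w x z)\<bar> \<le> 6 * \<theta> * real (card V) ^ 2" by simp
  have "(\<Sum>x\<in>V. \<Sum>z\<in>V. w x z) = (\<Sum>x\<in>V. \<Sum>z\<in>V. edge_sign (E x z))
      - edge_sign s * (\<Sum>x\<in>V. edge_sign (a x))\<^sup>2"
    by (simp add: w_def sum_subtractf power2_eq_square sum_product flip: sum_distrib_left)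
  then have "real_of_int (\<Sum>x\<in>V. \<Sum>z\<in>V. w x z) = real_of_int (\<Sum>x\<in>V. \<Sum>z\<in>V. edge_sign (E x z))
      - real_of_int (edge_sign s) * (real_of_int (\<Sum>x\<in>V. edge_sign (a x)))\<^sup>2"
    by simp
  then have eq: "real_of_int (\<Sum>x\<in>V. \<Sum>z\<in>V. w x z) = real_of_int (\<Sum>x\<in>V. \<Sum>z\<in>V. edge_sign (E x z))
      - (if s then 1 else - 1) * (real_of_int (\<Sum>x\<in>V. edge_sign (a x)))\<^sup>2"
    by (simp add: edge_sign_def)
  show ?thesis
  proof (cases s)
    case True
    then show ?thesis using diff total eq[unfolded if_P[OF True]] by linarith
  next
    case False
    then show ?thesis using diff total eq[unfolded if_not_P[OF False]] by linarith
  qed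
qed

section \<open>Edit distance to the balanced block graphs\<close>

text \<open>Shrinking or enlarging \<open>A\<close> gives nested sets, whose symmetric difference is
  as large as the difference of their sizes.\<close>

lemma ex_subset_card_close:
  assumes "finite V" "A \<subseteq> V" "k \<le> card V"
  obtains A' where "A' \<subseteq> V" "card A' = k" "real (card (sym_diff A A')) = \<bar>real (card A) - real k\<bar>"
proof (cases "k \<le> card A")
  case True
  obtain A' where A': "A' \<subseteq> A" "card A' = k"
    using obtain_subset_with_card_n[OF True] by blast
  then have sub: "A' \<subseteq> V" using assms(2) by blast
  then have "finite A'" using assms(1) by (rule finite_subset)
  moreover have "sym_diff A A' = A - A'" using A' by blast
  ultimately have "card (sym_diff A A') = card A - k" using A' by (simp add: card_Diff_subset)
  then show ?thesis using that[OF sub A'(2)] True by simp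
next
  case False
  then obtain A' where A': "A \<subseteq> A'" "A' \<subseteq> V" "card A' = k"
    using exists_subset_between[of A k V] assms by (metis nat_le_linear)
  have "finite A" using assms finite_subset by blast
  moreover have "sym_diff A A' = A' - A" using A' by blast
  ultimately have "card (sym_diff A A') = k - card A" using A' by (simp add: card_Diff_subset)
  then show ?thesis using that[OF A'(2,3)] False by simp
qed

text \<open>One description of both extremal graphs, with "same side" tested by
  \<open>range Inl\<close>, so that the edit distance is estimated only once.\<close>

lemma edges_two_blocks:
  "edges (if s then two_cliques a b else complete_bipartite a b) =
    {{p, q} | p q. p \<in> {..<a} <+> {..<b} \<and> q \<in> {..<a} <+> {..<b} \<and> p \<noteq> q \<and>
      ((p \<in> range Inl \<longleftrightarrow> q \<in> range Inl) = s)}" (is "?E = ?R")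
proof (rule set_eqI, rule iffI)
  fix e assume e: "e \<in> ?E"
  have R: "{p, q} \<in> ?R" if "p \<in> {..<a} <+> {..<b}" "q \<in> {..<a} <+> {..<b}" "p \<noteq> q"
    "(p \<in> range Inl \<longleftrightarrow> q \<in> range Inl) = s" for p q
    using that by blast
  show "e \<in> ?R"
  proof (cases s)
    case True
    then consider i j where "e = {Inl i, Inl j}" "i < a" "j < a" "i \<noteq> j"
      | i j where "e = {Inr i, Inr j}" "i < b" "j < b" "i \<noteq> j"
      using e by (auto simp: two_cliques_def)
    then show ?thesis
    proof cases
      case 1
      show ?thesis unfolding 1(1) by (rule R) (use 1 True in auto)
    next
      case 2
      show ?thesis unfolding 2(1) by (rule R) (use 2 True in auto)
    qed
  next
    case False
    then obtain i j where ij: "e = {Inl i, Inr j}" "i < a" "j < b"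
      using e by (auto simp: complete_bipartite_def)
    show ?thesis unfolding ij(1) by (rule R) (use ij False in auto)
  qed
next
  fix e assume "e \<in> ?R"
  then obtain p q where pq: "e = {p, q}" "p \<in> {..<a} <+> {..<b}" "q \<in> {..<a} <+> {..<b}" "p \<noteq> q"
    "(p \<in> range Inl \<longleftrightarrow> q \<in> range Inl) = s" by blast
  then show "e \<in> ?E"
    by (cases p; cases q) (auto simp: two_cliques_def complete_bipartite_def insert_commute)
qed

text \<open>Any bijection bounds the least value from above; the one used sends the left block onto
  \<open>A\<close>. The ordered count is generous: it sees each wrong edge in both orders, and the
  diagonal too when \<open>s\<close> holds.\<close>

lemma edit_distance_two_blocks_le:
  fixes G :: "'a graph"
  assumes G: "simple_graph G" and A: "A \<subseteq> verts G"
    and ab: "card A = a" "card (verts G - A) = b"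
  shows "edit_distance G (if s then two_cliques a b else complete_bipartite a b) \<le>
    card {r \<in> verts G \<times> verts G. adjacent G (fst r) (snd r) \<noteq> ((fst r \<in> A \<longleftrightarrow> snd r \<in> A) = s)}"
    (is "edit_distance G ?H \<le> card ?B")
proof -
  have fin: "finite (verts G)" using G by (simp add: simple_graph_def)
  then have finA: "finite A" "finite (verts G - A)" using A finite_subset by auto
  obtain h where h: "bij_betw h {..<a} A"
    using ex_bij_betw_nat_finite[OF finA(1)] ab(1) atLeast0LessThan by metis
  obtain k where k: "bij_betw k {..<b} (verts G - A)"
    using ex_bij_betw_nat_finite[OF finA(2)] ab(2) atLeast0LessThan by metis
  define f where "f = case_sum h k"
  have f_simps: "f (Inl i) = h i" "f (Inr j) = k j" for i j by (simp_all add: f_def)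
  have hA: "h ` {..<a} = A" and kA: "k ` {..<b} = verts G - A"
    using h k by (auto simp: bij_betw_def)
  have vH: "verts ?H = {..<a} <+> {..<b}" by (simp add: two_cliques_def complete_bipartite_def)
  have im: "f ` ({..<a} <+> {..<b}) = verts G"
  proof -
    have "f ` ({..<a} <+> {..<b}) = h ` {..<a} \<union> k ` {..<b}"
      by (simp add: Plus_def image_Un image_image f_simps)
    then show ?thesis using A by (simp add: hA kA Un_absorb1)
  qed
  have "card ({..<a} <+> {..<b}) = card (verts G)"
    using ab finA card_mono[OF fin A] by (simp add: card_Plus card_Diff_subset[OF finA(1) A])
  then have bij: "bij_betw f (verts ?H) (verts G)"
    unfolding vH bij_betw_def using im by (simp add: eq_card_imp_inj_on)
  have h_in: "h i \<in> A" if "i < a" for i using that hA by blast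
  have k_notin: "k j \<notin> A" if "j < b" for j using that kA by blast
  have mem: "f p \<in> A \<longleftrightarrow> p \<in> range Inl" if "p \<in> {..<a} <+> {..<b}" for p
    using that by (cases p) (auto simp: f_simps h_in k_notin)
  have inH: "e \<in> (`) f ` edges ?H \<longleftrightarrow>
      (\<exists>x z. e = {x, z} \<and> x \<noteq> z \<and> x \<in> verts G \<and> z \<in> verts G \<and> ((x \<in> A \<longleftrightarrow> z \<in> A) = s))" for e
  proof
    assume "e \<in> (`) f ` edges ?H"
    then obtain p q where pq: "p \<in> {..<a} <+> {..<b}" "q \<in> {..<a} <+> {..<b}" "p \<noteq> q"
      "e = {f p, f q}" "(p \<in> range Inl \<longleftrightarrow> q \<in> range Inl) = s"
      unfolding edges_two_blocks by blast
    have "f p \<noteq> f q"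
      using bij pq unfolding vH bij_betw_def by (auto dest: inj_onD)
    moreover have "f p \<in> verts G" "f q \<in> verts G" using pq(1,2) im by blast+
    moreover have "(f p \<in> A \<longleftrightarrow> f q \<in> A) = s" by (simp only: mem pq)
    ultimately show "\<exists>x z. e = {x, z} \<and> x \<noteq> z \<and> x \<in> verts G \<and> z \<in> verts G \<and> ((x \<in> A \<longleftrightarrow> z \<in> A) = s)"
      using pq(4) by blast
  next
    assume "\<exists>x z. e = {x, z} \<and> x \<noteq> z \<and> x \<in> verts G \<and> z \<in> verts G \<and> ((x \<in> A \<longleftrightarrow> z \<in> A) = s)"
    then obtain x z where xz: "e = {x, z}" "x \<noteq> z" "x \<in> verts G" "z \<in> verts G"
      "(x \<in> A \<longleftrightarrow> z \<in> A) = s" by blast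
    obtain p q where pq: "p \<in> {..<a} <+> {..<b}" "q \<in> {..<a} <+> {..<b}" "x = f p" "z = f q"
      using xz(3,4) im by (metis imageE)
    have "p \<noteq> q" "(p \<in> range Inl \<longleftrightarrow> q \<in> range Inl) = s"
      using xz pq mem by auto
    then have "{p, q} \<in> edges ?H"
      using pq(1,2) unfolding edges_two_blocks by blast
    moreover have "e = f ` {p, q}" using xz(1) pq by simp
    ultimately show "e \<in> (`) f ` edges ?H" by blast
  qed
  have B: "(x, z) \<in> ?B"
    if "x \<in> verts G" "z \<in> verts G" "adjacent G x z \<noteq> ((x \<in> A \<longleftrightarrow> z \<in> A) = s)" for x z
    by (rule CollectI) (simp only: mem_Times_iff fst_conv snd_conv that simp_thms)
  have "edit_distance G ?H \<le> card (sym_diff (edges G) ((`) f ` edges ?H))"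
    unfolding edit_distance_def by (rule Least_le) (use bij in blast)
  also have "\<dots> \<le> card ((\<lambda>r. {fst r, snd r}) ` ?B)"
  proof (rule card_mono)
    show "finite ((\<lambda>r. {fst r, snd r}) ` ?B)" using fin by simp
    show "sym_diff (edges G) ((`) f ` edges ?H) \<subseteq> (\<lambda>r. {fst r, snd r}) ` ?B"
    proof
      fix e assume e: "e \<in> sym_diff (edges G) ((`) f ` edges ?H)"
      show "e \<in> (\<lambda>r. {fst r, snd r}) ` ?B"
      proof (cases "e \<in> edges G")
        case True
        then have "e \<subseteq> verts G" "card e = 2" using G by (auto simp: simple_graph_def)
        then obtain x z where xz: "e = {x, z}" "x \<noteq> z" "x \<in> verts G" "z \<in> verts G"
          by (auto simp: card_2_iff)
        have "e \<notin> (`) f ` edges ?H" using e True by blast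
        then have side: "(x \<in> A \<longleftrightarrow> z \<in> A) \<noteq> s" using xz unfolding inH by blast
        have adj: "adjacent G x z" using xz(1) True by (simp add: adjacent_def)
        have "(x, z) \<in> ?B" by (rule B[OF xz(3,4)]) (simp only: adj side simp_thms)
        then show ?thesis unfolding xz(1) by (rule rev_image_eqI) simp
      next
        case False
        then have "e \<in> (`) f ` edges ?H" using e by blast
        then obtain x z where xz: "e = {x, z}" "x \<in> verts G" "z \<in> verts G"
          and side: "(x \<in> A \<longleftrightarrow> z \<in> A) = s" unfolding inH by blast
        have adj: "\<not> adjacent G x z" using xz(1) False by (simp add: adjacent_def)
        have "(x, z) \<in> ?B" by (rule B[OF xz(2,3)]) (simp only: adj side simp_thms)
        then show ?thesis unfolding xz(1) by (rule rev_image_eqI) simp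
      qed
    qed
  qed
  also have "\<dots> \<le> card ?B" using fin by (intro card_image_le) simp
  finally show ?thesis .
qed

text \<open>The side \<open>A\<close> is adjusted to a set \<open>A'\<close> of exactly
  \<open>n div 2\<close> vertices. Each of the at most \<open>(3 \<beta> n + 1) / 2\<close> moved
  vertices affects at most \<open>2 n\<close> ordered pairs.\<close>

lemma edit_distance_near_two_blocks_le:
  fixes G :: "'a graph" and \<beta> :: real
  assumes G: "simple_graph G" and n: "n = card (verts G)" and \<beta>: "0 < \<beta>" "\<beta> \<le> 1"
    and bad: "real (card {r \<in> verts G \<times> verts G.
      adjacent G (fst r) (snd r) \<noteq> ((c (fst r) = c (snd r)) = s)}) \<le> 3 * \<beta>\<^sup>2 * real n ^ 2"
    and bal: "(real_of_int (\<Sum>x\<in>verts G. edge_sign (c x)))\<^sup>2 \<le> 7 * \<beta>\<^sup>2 * real n ^ 2"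
  shows "real (edit_distance G
      (if s then two_cliques (n div 2) (n - n div 2) else complete_bipartite (n div 2) (n - n div 2)))
    \<le> 6 * \<beta> * real n ^ 2 + real n"
proof -
  let ?V = "verts G"
  define A where "A = {x \<in> ?V. c x}"
  have fin: "finite ?V" using G by (simp add: simple_graph_def)
  have A: "A \<subseteq> ?V" by (auto simp: A_def)
  have "(\<Sum>x\<in>?V. edge_sign (c x)) = 2 * int (card A) - int n"
  proof -
    have "(\<Sum>x\<in>?V. edge_sign (c x)) = (\<Sum>x\<in>?V. 2 * of_bool (c x) - 1)"
      by (intro sum.cong) (auto simp: edge_sign_def)
    also have "\<dots> = 2 * (\<Sum>x\<in>?V. of_bool (c x)) - int n"
      by (simp add: sum_subtractf n flip: sum_distrib_left)
    also have "(\<Sum>x\<in>?V. of_bool (c x)) = int (card A)"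
      using fin by (simp add: of_bool_def sum.If_cases A_def Int_def)
    finally show ?thesis .
  qed
  then have "(2 * real (card A) - real n)\<^sup>2 \<le> 7 * \<beta>\<^sup>2 * real n ^ 2" using bal by simp
  \<comment> \<open>7 is rounded up to a perfect square before taking the root.\<close>
  also have "\<dots> \<le> 9 * (\<beta>\<^sup>2 * real n ^ 2)" by simp
  also have "\<dots> = (3 * \<beta> * real n)\<^sup>2" by (simp add: power_mult_distrib)
  finally have "\<bar>2 * real (card A) - real n\<bar> \<le> 3 * \<beta> * real n"
    by (rule abs_le_square_iff[THEN iffD2, THEN order_trans]) (use \<beta> in simp)
  \<comment> \<open>The error 1 accounts for odd \<open>n\<close>.\<close>
  moreover have "\<bar>real n - 2 * real (n div 2)\<bar> \<le> 1" by linarith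
  ultimately have "\<bar>2 * real (card A) - 2 * real (n div 2)\<bar> \<le> 3 * \<beta> * real n + 1"
    unfolding abs_le_iff by argo
  then have close: "2 * \<bar>real (card A) - real (n div 2)\<bar> \<le> 3 * \<beta> * real n + 1"
    unfolding abs_le_iff by argo
  obtain A' where A': "A' \<subseteq> ?V" "card A' = n div 2"
    "real (card (sym_diff A A')) = \<bar>real (card A) - real (n div 2)\<bar>"
    using ex_subset_card_close[OF fin A, of "n div 2"] n by (metis div_le_dividend)
  have cb: "card (?V - A') = n - n div 2"
    using A' n fin finite_subset by (metis card_Diff_subset)
  let ?bad = "{r \<in> ?V \<times> ?V. adjacent G (fst r) (snd r) \<noteq> ((c (fst r) = c (snd r)) = s)}"
  let ?D = "sym_diff A A'"
  have finD: "finite ?D" using fin A A'(1) by (meson finite_Diff finite_Un finite_subset)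
  have sub: "{r \<in> ?V \<times> ?V. adjacent G (fst r) (snd r) \<noteq> ((fst r \<in> A' \<longleftrightarrow> snd r \<in> A') = s)}
      \<subseteq> ?bad \<union> (?D \<times> ?V \<union> ?V \<times> ?D)"
  proof
    fix r assume r: "r \<in> {r \<in> ?V \<times> ?V. adjacent G (fst r) (snd r) \<noteq> ((fst r \<in> A' \<longleftrightarrow> snd r \<in> A') = s)}"
    then have V: "fst r \<in> ?V" "snd r \<in> ?V" by auto
    show "r \<in> ?bad \<union> (?D \<times> ?V \<union> ?V \<times> ?D)"
    proof (cases "fst r \<in> ?D \<or> snd r \<in> ?D")
      case True
      then show ?thesis using V by (auto simp: mem_Times_iff)
    next
      case False
      then have "fst r \<in> A' \<longleftrightarrow> c (fst r)" "snd r \<in> A' \<longleftrightarrow> c (snd r)"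
        using V by (auto simp: A_def)
      then show ?thesis using r by auto
    qed
  qed
  have "edit_distance G
      (if s then two_cliques (n div 2) (n - n div 2) else complete_bipartite (n div 2) (n - n div 2))
      \<le> card {r \<in> ?V \<times> ?V. adjacent G (fst r) (snd r) \<noteq> ((fst r \<in> A' \<longleftrightarrow> snd r \<in> A') = s)}"
    by (rule edit_distance_two_blocks_le[OF G A'(1,2) cb])
  also have "\<dots> \<le> card (?bad \<union> (?D \<times> ?V \<union> ?V \<times> ?D))"
    using fin finD by (intro card_mono[OF _ sub]) simp
  also have "\<dots> \<le> card ?bad + (card (?D \<times> ?V) + card (?V \<times> ?D))"
    using card_Un_le[of ?bad "?D \<times> ?V \<union> ?V \<times> ?D"] card_Un_le[of "?D \<times> ?V" "?V \<times> ?D"]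
    by linarith
  also have "\<dots> = card ?bad + 2 * card ?D * n"
    by (simp add: card_cartesian_product n)
  finally have "real (edit_distance G
      (if s then two_cliques (n div 2) (n - n div 2) else complete_bipartite (n div 2) (n - n div 2)))
      \<le> real (card ?bad + 2 * card ?D * n)"
    by (simp only: of_nat_le_iff)
  also have "\<dots> = real (card ?bad) + 2 * real (card ?D) * real n" by simp
  also have "\<dots> \<le> 3 * \<beta>\<^sup>2 * real n ^ 2 + (3 * \<beta> * real n + 1) * real n"
    using bad close A'(3) by (intro add_mono mult_right_mono) auto
  \<comment> \<open>\<open>\<beta> \<le> 1\<close> gives
    \<open>\<beta>^2 \<le> \<beta>\<close>.\<close>
  also have "\<dots> \<le> 3 * \<beta> * real n ^ 2 + (3 * \<beta> * real n + 1) * real n"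
    using \<beta> by (intro add_right_mono mult_right_mono) (auto simp: power2_eq_square mult_left_le)
  also have "\<dots> = 6 * \<beta> * real n ^ 2 + real n" by (simp add: power2_eq_square algebra_simps)
  finally show ?thesis .
qed

section \<open>Choice of the constants\<close>

theorem lemma4p1:
  fixes \<epsilon> :: real
  assumes "\<epsilon> > 0"
  shows "\<exists>\<delta>>0. \<exists>n0::nat. \<forall>G :: 'a graph.
    simple_graph G \<and> card (verts G) \<ge> n0 \<and> edge_inducibility_density 4 3 G \<ge> 1 / 2 - \<delta> \<longrightarrow>
      (let n = card (verts G); a = n div 2; b = n - n div 2 in
        real (edit_distance G (complete_bipartite a b)) \<le> \<epsilon> * real (n choose 2) \<or>
        real (edit_distance G (two_cliques a b)) \<le> \<epsilon> * real (n choose 2))"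
proof -
  \<comment> \<open>The final error is \<open>6 \<beta> n^2 + n\<close>; the factor 48 makes its
    first term at most \<open>\<epsilon> n^2 / 8\<close>.\<close>
  define \<beta> where "\<beta> = min 1 (\<epsilon> / 48)"
  have \<beta>: "0 < \<beta>" "\<beta> \<le> 1" "48 * \<beta> \<le> \<epsilon>" using assms by (auto simp: \<beta>_def)
  define \<delta> where "\<delta> = \<beta> ^ 4 / 3000"
  have \<delta>: "0 < \<delta>" using \<beta> by (simp add: \<delta>_def)
  \<comment> \<open>\<open>6 / \<delta>\<close> absorbs the cubic error in the count of quadruples,
    and \<open>8 / \<epsilon>\<close> makes the remaining \<open>n\<close> at most
    \<open>\<epsilon> n^2 / 8\<close>.\<close>
  define n0 where "n0 = max 4 (max (nat \<lceil>6 / \<delta>\<rceil>) (nat \<lceil>8 / \<epsilon>\<rceil>))"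
  have concl: "let n = card (verts G); a = n div 2; b = n - n div 2 in
      real (edit_distance G (complete_bipartite a b)) \<le> \<epsilon> * real (n choose 2) \<or>
      real (edit_distance G (two_cliques a b)) \<le> \<epsilon> * real (n choose 2)"
    if G: "simple_graph G" and n0: "card (verts G) \<ge> n0"
      and dens: "edge_inducibility_density 4 3 G \<ge> 1 / 2 - \<delta>" for G :: "'a graph"
  proof -
    define n where "n = card (verts G)"
    have n: "4 \<le> n" "6 / \<delta> \<le> real n" "8 / \<epsilon> \<le> real n"
      using n0 unfolding n_def[symmetric] n0_def by linarith+
    have fin: "finite (verts G)" using G by (simp add: simple_graph_def)
    have ne: "verts G \<noteq> {}" using n(1) by (auto simp: n_def)
    \<comment> \<open>Both bounds of \<open>small\<close> have the form required of
      \<open>\<theta>\<close> in the structure and balance lemmas, with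
      \<open>\<theta> = \<beta>^2\<close>.\<close>
    note small = edge_sum_and_odd_cycles_small[OF G \<beta>(1,2) \<delta>_def n_def n(1,2) dens]
    obtain c :: "'a \<Rightarrow> bool" and s where cs: "real (card {r \<in> verts G \<times> verts G.
        adjacent G (fst r) (snd r) \<noteq> ((c (fst r) = c (snd r)) = s)}) \<le> 3 * \<beta>\<^sup>2 * real (card (verts G)) ^ 2"
      by (rule two_block_structure[OF fin ne adjacent_commute small(2)[unfolded n_def]]) (rule that)
    have "(real_of_int (\<Sum>x\<in>verts G. edge_sign (c x)))\<^sup>2 \<le> 7 * \<beta>\<^sup>2 * real n ^ 2"
      unfolding n_def by (rule block_balance[OF fin small(1)[unfolded n_def] cs])
    note edit_distance_near_two_blocks_le[OF G n_def \<beta>(1,2) cs[folded n_def] this]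
    also have "6 * \<beta> * real n ^ 2 + real n \<le> \<epsilon> / 4 * real n ^ 2"
    proof -
      have "8 \<le> real n * \<epsilon>" using n(3) assms by (simp add: pos_divide_le_eq)
      then have "8 * real n \<le> real n * \<epsilon> * real n" by (intro mult_right_mono) auto
      moreover have "48 * \<beta> * real n ^ 2 \<le> \<epsilon> * real n ^ 2"
        using \<beta>(3) by (intro mult_right_mono) auto
      ultimately show ?thesis by (simp add: power2_eq_square algebra_simps)
    qed
    \<comment> \<open>For \<open>n \<ge> 2\<close>, \<open>n choose 2\<close> is at least
      \<open>n^2 / 4\<close>.\<close>
    also have "\<epsilon> / 4 * real n ^ 2 \<le> \<epsilon> * real (n choose 2)"
    proof -
      have "real (n choose 2) = real n * (real n - 1) / 2"
        using n(1) by (simp add: choose_two real_of_nat_div)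
      moreover have "real n * 2 \<le> real n * real n" using n(1) by (intro mult_left_mono) auto
      ultimately have "real n ^ 2 / 4 \<le> real (n choose 2)"
        by (simp add: power2_eq_square algebra_simps)
      then show ?thesis using assms mult_left_mono[of "real n ^ 2 / 4" _ \<epsilon>] by simp
    qed
    \<comment> \<open>The value of \<open>s\<close> decides which of the two extremal graphs is
      close.\<close>
    finally show ?thesis by (cases s) (simp_all add: Let_def n_def)
  qed
  show ?thesis using \<delta> concl by blast
qed

end
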